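(* Let $p=\operatorname{char}(K\nu)$ be the characteristic of the residue field of $\nu$, and let $I=\{p^t: t\ge 0\}$ if $p>0$ and $I=\{1\}$ if $p=0$. Then: (i) There exists $\sigma<\lambda$ such that for every $\theta$ with $\sigma<\theta<\lambda$ the polynomial \[ F_p=L(h_\theta)+\sum_{i\in I}\partial_iL(h_\theta)\,Q_\theta^{\,i} \] is a limit key polynomial for $\Psi_n$. (ii) For such $\theta$, there exist $a_i\in K[x]_n$, $i\in I\cup\{0\}$, such that \[ \overline F_p=\sum_{i\in I\cup\{0\}}a_iQ_\theta^{\,i} \] is a limit key polynomial for $\Psi_n$.
   Context: Let $K$ be a field and $\nu$ a rank one valuation on $K[x]$ (values in $\mathbb{R}\cup\{\infty\}$). For $f\in K[x]$ and $b\ge 0$, $\partial_bf$ denotes the $b$-th Hasse derivative of $f$ (defined by $f(x+y)=\sum_b\partial_bf(x)y^b$). For nonconstant $f$ set $\epsilon(f)=\max_{1\le b\le\deg f}\frac{\nu(f)-\nu(\partial_bf)}{b}$ (with $\epsilon(c)=-\infty$ for constants $c$). A monic $Q\in K[x]$ is a key polynomial for $\nu$ if for every $f\in K[x]$, $\epsilon(f)\ge\epsilon(Q)$ implies $\deg f\ge\deg Q$. For a monic $Q$ of degree $n\ge1$, every $f\in K[x]$ has a unique $Q$-expansion $f=\sum_{i=0}^ra_iQ^i$ with $\deg a_i<n$, and the truncation is $\nu_Q(f)=\min_i\nu(a_iQ^i)$. Let $K[x]_n=\{a\in K[x]:\deg a<n\}$; thus $f=l(Q)$ with $l(X)=\sum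 a_iX^i\in K[x]_n[X]$. For $l(X)\in K[x]_n[X]$ and $g\in K[x]$, $l(g)$ is evaluation, and $\partial_il$ is the $i$-th Hasse derivative with respect to $X$ ($\partial_iX^k=\binom{k}{i}X^{k-i}$). Standing setup: fix $n\ge1$ and let $\Psi_n$ be the set of key polynomials for $\nu$ of degree $n$. Assume $\Psi_n\ne\emptyset$, there is $a\in K[x]$ with $\nu(a)>\nu(Q')$ for all $Q'\in\Psi_n$, and $\{\nu(Q'):Q'\in\Psi_n\}$ has no maximum. For $f\in K[x]$ the number $r$ in its $Q'$-expansion is the same for all $Q'\in\Psi_n$; denote it $\deg_X(f)$. Let $S_n=\{f\in K[x]:\nu_{Q'}(f)<\nu(f)\text{ for every }Q'\in\Psi_n\}$; $f$ is $\Psi_n$-stable if $f\notin S_n$. A limit key polynomial for $\Psi_n$ is a monic element of $S_n$ of smallest degree among elements of $S_n$. Fix a limit key polynomial $F$ and set $d=\deg_X(F)$, $B=\sup_{Q'\in\Psi_n}\nu(Q')$, $\overline B=\sup_{Q'\in\Psi_n}\nu_{Q'}(F)$ (assumed real). Fix $Q_0\in\Psi_n$ and $Q\in\Psi_n$ with $\epsilon(Q)-\epsilon(Q_0)>d(B-\nu(Q))$ and $\epsilon(Q)-\epsilon(Q_0)>\overline B-\nu_Q(F)$. Write $F=L(Q)$ with $L\in K[x]_n[X]$ (from the $Q$-expansion). Fix a limit ordinal $\lambda$ and a family $\{Q_\rho\}_{\rho<\lambda}\subseteq\{Q'\in\Psi_n:\epsilon(Q)<\epsilon(Q')\}$ with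 $\nu(Q_\rho)<\nu(Q_\sigma)$ for $\rho<\sigma<\lambda$ and such that for every $Q'\in\Psi_n$ there is $\rho<\lambda$ with $\nu(Q')<\nu(Q_\rho)$. Set $h_\rho=Q-Q_\rho\in K[x]_n$, $\gamma_\rho=\nu(Q_\rho)$, $\nu_\rho=\nu_{Q_\rho}$. *)

theory Defs
  imports "HOL-Computational_Algebra.Polynomial" "HOL-Library.Extended_Real"
begin

definition rank_one_valuation :: "('a::field poly \<Rightarrow> ereal) \<Rightarrow> bool" where
  "rank_one_valuation \<nu> \<longleftrightarrow>
     (\<forall>f g. \<nu> (f * g) = \<nu> f + \<nu> g) \<and>
     (\<forall>f g. min (\<nu> f) (\<nu> g) \<le> \<nu> (f + g)) \<and>
     \<nu> 0 = \<infinity> \<and> \<nu> 1 = 0 \<and> (\<forall>f. \<nu> f \<noteq> -\<infinity>)"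

text \<open>Characteristic of the residue field: the residue class of n*1 vanishes
  iff the value of n*1 is positive.\<close>
definition residue_char :: "('a::field poly \<Rightarrow> ereal) \<Rightarrow> nat" where
  "residue_char \<nu> = (if \<exists>m>0. \<nu> (of_nat m) > 0 then (LEAST m. m > 0 \<and> \<nu> (of_nat m) > 0) else 0)"

definition hasse :: "nat \<Rightarrow> 'a::comm_semiring_1 poly \<Rightarrow> 'a poly" where
  "hasse b f = (\<Sum>k\<le>degree f. monom (of_nat (k choose b) * coeff f k) (k - b))"

definition eps :: "('a::field poly \<Rightarrow> ereal) \<Rightarrow> 'a poly \<Rightarrow> ereal" where
  "eps \<nu> f = (if degree f = 0 then -\<infinity>
     else Max ((\<lambda>b. (\<nu> f - \<nu> (hasse b f)) / ereal (real b)) ` {1..degree f}))"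

definition key_poly :: "('a::field poly \<Rightarrow> ereal) \<Rightarrow> 'a poly \<Rightarrow> bool" where
  "key_poly \<nu> Q \<longleftrightarrow> lead_coeff Q = 1 \<and>
     (\<forall>f. eps \<nu> f \<ge> eps \<nu> Q \<longrightarrow> degree f \<ge> degree Q)"

text \<open>i-th coefficient of the Q-expansion f = sum_i a_i Q^i (deg a_i < deg Q).\<close>
definition qcoeff :: "'a::field poly \<Rightarrow> 'a poly \<Rightarrow> nat \<Rightarrow> 'a poly" where
  "qcoeff Q f i = (f div Q ^ i) mod Q"

definition degX :: "'a::field poly \<Rightarrow> 'a poly \<Rightarrow> nat" where
  "degX Q f = degree f div degree Q"

text \<open>The polynomial l(X) in K[x]_n[X] with f = l(Q).\<close>
definition qexp :: "'a::field poly \<Rightarrow> 'a poly \<Rightarrow> 'a poly poly" where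
  "qexp Q f = Poly (map (qcoeff Q f) [0..<Suc (degX Q f)])"

definition trunc_val :: "('a::field poly \<Rightarrow> ereal) \<Rightarrow> 'a poly \<Rightarrow> 'a poly \<Rightarrow> ereal" where
  "trunc_val \<nu> Q f = Min ((\<lambda>i. \<nu> (qcoeff Q f i * Q ^ i)) ` {0..degX Q f})"

definition Psi :: "('a::field poly \<Rightarrow> ereal) \<Rightarrow> nat \<Rightarrow> 'a poly set" where
  "Psi \<nu> n = {Q. key_poly \<nu> Q \<and> degree Q = n}"

definition S_set :: "('a::field poly \<Rightarrow> ereal) \<Rightarrow> nat \<Rightarrow> 'a poly set" where
  "S_set \<nu> n = {f. \<forall>Q'\<in>Psi \<nu> n. trunc_val \<nu> Q' f < \<nu> f}"

definition limit_key_poly :: "('a::field poly \<Rightarrow> ereal) \<Rightarrow> nat \<Rightarrow> 'a poly \<Rightarrow> bool" where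
  "limit_key_poly \<nu> n F \<longleftrightarrow> lead_coeff F = 1 \<and> F \<in> S_set \<nu> n \<and>
     (\<forall>g\<in>S_set \<nu> n. degree F \<le> degree g)"

end

(* The Gauss valuation w_e f = min_b (nu (hasse b f) + b e), i.e. the value of f(x + y) with y of
   weight e, is a valuation; it agrees with nu on f iff eps f <= e, and the truncation at a key
   polynomial Q is w_e for e = eps Q. So all truncations and the reduction errors of products modulo
   key polynomials can be read off one increasing family of valuations. By Taylor,
   F = sum_j hasse j L (h) Q'^j for every Q' of degree n, h = Q - Q', and the hypothesis on Q makes
   reducing the coefficients modulo Q' an error of value above Bbar. Since the derivatives
   hasse i L (Q), i > 0, have smaller degree than F, they are stable; as in Kaplansky's theory of
   pseudo-convergent sequences, this forces the j-th term to have value above Bbar eventually as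
   soon as some i < j, i > 0, has j choose i a unit in the residue field, i.e. for all j not in I.
   Dropping terms of value above Bbar stays in S_set, and minimality of deg F makes deg_X F an
   element of I, so the result is again monic of the right degree. *)

theory Submission
  imports Defs "HOL-Algebra.Exponent"
begin

section \<open>Hasse derivatives and Taylor expansion\<close>

text \<open>The obstacle is that the Taylor coefficients \<open>hasse j L (h)\<close> need not have
  degree below n, so the expansion at \<open>Q'\<close> is not its \<open>Q'\<close>-expansion and
  \<open>trunc\<close> cannot be read off it. At the fixed level \<open>eps_of Q0\<close> these
  coefficients are under control: those of \<open>L\<close>, and h itself, have degree below n, so
  there the Gauss valuation agrees with \<nu> on them and is multiplicative. What is discarded in a
  reduction is a multiple of a key polynomial, whose initial form involves y. The value of such a
  multiple grows at least with slope 1 in the level e, so it gains at least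
  \<open>eps Q - eps Q0\<close> on the way from \<open>Q0\<close> to \<open>Q\<close>. This is how
  the hypothesis comparing that difference with \<open>Bbar - trunc Q F\<close> enters. The final
  comparison involves two truncations, at a fixed \<open>Qs\<close> and at a moving
  \<open>Q'\<close> beyond it. Reduction errors modulo \<open>Q'\<close> are therefore measured at
  every earlier key polynomial from \<open>Q\<close> on. The index i = 0 gives no information there,
  because \<open>hasse 0 L (Q)\<close> is F, which is not stable.\<close>

lemma coeff_hasse: "coeff (hasse b f) j = of_nat ((j + b) choose b) * coeff f (j + b)"
proof -
  have "coeff (hasse b f) j =
      (\<Sum>k\<le>degree f. if k - b = j then of_nat (k choose b) * coeff f k else 0)"
    by (simp add: hasse_def coeff_sum if_distrib cong: if_cong)
  \<comment> \<open>For \<open>k < b\<close> the truncated difference \<open>k - b\<close> is 0, so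
    such k would count for \<open>j = 0\<close>; their binomials vanish.\<close>
  also have "\<dots> = (\<Sum>k\<le>degree f. if k = j + b then of_nat (k choose b) * coeff f k else 0)"
  proof (rule sum.cong)
    fix k
    show "(if k - b = j then of_nat (k choose b) * coeff f k else 0) =
          (if k = j + b then of_nat (k choose b) * coeff f k else 0)"
      by (cases "k < b") (auto simp: binomial_eq_0)
  qed simp
  also have "\<dots> = of_nat ((j + b) choose b) * coeff f (j + b)"
    by (auto simp: sum.delta coeff_eq_0)
  finally show ?thesis .
qed

lemma hasse_0 [simp]: "hasse 0 f = f"
  by (rule poly_eqI) (simp add: coeff_hasse)

lemma hasse_zero [simp]: "hasse b 0 = 0"
  by (rule poly_eqI) (simp add: coeff_hasse)

lemma hasse_eq_0: "degree f < b \<Longrightarrow> hasse b f = 0"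
  by (rule poly_eqI) (simp add: coeff_hasse coeff_eq_0)

lemma hasse_degree: "hasse (degree f) f = [:lead_coeff f:]"
  by (rule poly_eqI) (auto simp: coeff_hasse coeff_eq_0 coeff_pCons split: nat.split)

lemma hasse_add: "hasse b (f + g) = hasse b f + hasse b g"
  by (rule poly_eqI) (simp add: coeff_hasse algebra_simps)

lemma hasse_diff: "hasse b (f - g) = hasse b f - hasse b (g :: 'a::comm_ring_1 poly)"
  by (rule poly_eqI) (simp add: coeff_hasse algebra_simps)

lemma hasse_smult: "hasse b (smult c f) = smult c (hasse b f)"
  by (rule poly_eqI) (simp add: coeff_hasse algebra_simps)

text \<open>Pascal's rule, read as the product rule for multiplication by the variable; it drives
  the inductions below.\<close>

lemma hasse_Suc_pCons: "hasse (Suc b) (pCons a f) = pCons 0 (hasse (Suc b) f) + hasse b f"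
proof (rule poly_eqI)
  fix j
  show "coeff (hasse (Suc b) (pCons a f)) j = coeff (pCons 0 (hasse (Suc b) f) + hasse b f) j"
    by (cases j) (simp_all add: coeff_hasse algebra_simps)
qed

lemma linear_mult: "[:h, 1:] * f = smult h f + pCons 0 (f :: 'a::comm_semiring_1 poly)"
  by simp

text \<open>The identity f(x + y) = sum of \<open>hasse m f\<close> (x) y^m, with x replaced by h
  and y as the variable.\<close>

lemma coeff_pcompose_linear: "coeff (pcompose f [:h, 1:]) m = poly (hasse m f) h"
proof (induction f arbitrary: m)
  case (pCons a f)
  show ?case
    by (cases m) (simp_all add: pcompose_pCons linear_mult hasse_Suc_pCons pCons.IH
        del: mult_pCons_left)
qed simp

lemma hasse_pcompose_linear: "hasse m (pcompose f [:h, 1:]) = pcompose (hasse m f) [:h, 1:]"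
proof (induction f arbitrary: m)
  case (pCons a f)
  show ?case
  proof (cases m)
    case (Suc k)
    have c: "hasse (Suc k) [:a:] = 0"
      by (simp add: hasse_eq_0)
    show ?thesis
      unfolding Suc pcompose_pCons linear_mult hasse_add hasse_Suc_pCons hasse_smult pCons.IH
        c pcompose_add
      by (simp add: pcompose_pCons algebra_simps)
  qed simp
qed simp

text \<open>The polynomial f(x + y) in K[x][y]: coefficients of f become constants of K[x], and
  \<open>[:[:0, 1:], 1:]\<close> is x + y. As a composition it is visibly multiplicative, which
  gives the product rule for Hasse derivatives without binomial sums.\<close>

definition taylor :: "'a::comm_ring_1 poly \<Rightarrow> 'a poly poly" where
  "taylor f = pcompose (map_poly (\<lambda>c. [:c:]) f) [:[:0, 1:], 1:]"

lemma map_poly_const_mult: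
  "map_poly (\<lambda>c. [:c:]) (f * g) =
   map_poly (\<lambda>c. [:c:]) f * map_poly (\<lambda>c. [:c:]) (g :: 'a::comm_ring_1 poly)"
proof -
  have s: "[:sum u A:] = (\<Sum>i\<in>A. [:u i :: 'a:])" for u and A :: "nat set"
  proof (induction A rule: infinite_finite_induct)
    case (insert x A)
    have "[:sum u (insert x A):] = [:u x:] + [:sum u A:]"
      using insert.hyps by simp
    then show ?case
      using insert by (simp del: add_pCons)
  qed simp_all
  show ?thesis
    by (rule poly_eqI) (simp add: coeff_map_poly coeff_mult s mult.commute)
qed

lemma taylor_mult: "taylor (f * g) = taylor f * taylor g"
  by (simp add: taylor_def map_poly_const_mult pcompose_mult)

lemma taylor_add: "taylor (f + g) = taylor f + taylor g"
proof -
  have "map_poly (\<lambda>c. [:c:]) (f + g) = map_poly (\<lambda>c. [:c:]) f + map_poly (\<lambda>c. [:c:]) g"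
    by (rule poly_eqI) (simp add: coeff_map_poly)
  then show ?thesis
    by (simp add: taylor_def pcompose_add)
qed

lemma coeff_taylor: "coeff (taylor f) b = hasse b f"
proof -
  have "hasse b (map_poly (\<lambda>c. [:c:]) f) = map_poly (\<lambda>c. [:c:]) (hasse b f)"
    by (rule poly_eqI) (simp add: coeff_map_poly coeff_hasse of_nat_poly)
  moreover have "poly (map_poly (\<lambda>c. [:c:]) g) [:0, 1:] = g" for g :: "'a poly"
    by (induction g) (auto simp: map_poly_pCons)
  ultimately show ?thesis
    by (simp add: taylor_def coeff_pcompose_linear)
qed

section \<open>Valuations\<close>

locale poly_valuation =
  fixes \<nu> :: "'a::field poly \<Rightarrow> ereal"
  assumes val: "rank_one_valuation \<nu>"
begin

lemma val_mult: "\<nu> (f * g) = \<nu> f + \<nu> g"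
  and val_add: "min (\<nu> f) (\<nu> g) \<le> \<nu> (f + g)"
  and val_0: "\<nu> 0 = \<infinity>"
  and val_1: "\<nu> 1 = 0"
  and val_ninf: "\<nu> f \<noteq> -\<infinity>"
  using val by (auto simp: rank_one_valuation_def)

lemma val_minus: "\<nu> (- f) = \<nu> f"
proof -
  have "\<nu> (- 1) + \<nu> (- 1) = 0"
    using val_mult[of "- 1" "- 1"] by (simp add: val_1)
  then have "\<nu> (- 1) = 0"
    by (cases "\<nu> (- 1)") (auto simp: zero_ereal_def)
  then show ?thesis
    using val_mult[of "- 1" f] by simp
qed

lemma val_diff: "min (\<nu> f) (\<nu> g) \<le> \<nu> (f - g)"
  using val_add[of f "- g"] by (simp add: val_minus)

lemma val_add_eq: "\<nu> f < \<nu> g \<Longrightarrow> \<nu> (f + g) = \<nu> f"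
  using val_add[of f g] val_diff[of "f + g" g] by (auto simp: min_def split: if_splits)

lemma val_sum_ge: "(\<And>i. i \<in> A \<Longrightarrow> c \<le> \<nu> (u i)) \<Longrightarrow> c \<le> \<nu> (sum u A)"
proof (induction A rule: infinite_finite_induct)
  case (insert x A)
  then have "c \<le> min (\<nu> (u x)) (\<nu> (sum u A))"
    by simp
  then show ?case
    using insert.hyps val_add[of "u x" "sum u A"] by (simp del: min.bounded_iff)
qed (simp_all add: val_0)

lemma val_sum_gt:
  "(\<And>i. i \<in> A \<Longrightarrow> c < \<nu> (u i)) \<Longrightarrow> c < \<infinity> \<Longrightarrow> c < \<nu> (sum u A)"
proof (induction A rule: infinite_finite_induct)
  case (insert x A)
  then have "c < min (\<nu> (u x)) (\<nu> (sum u A))"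
    by simp
  then show ?case
    using insert.hyps val_add[of "u x" "sum u A"] by (simp del: min_less_iff_conj)
qed (simp_all add: val_0)

lemma val_of_nat: "0 \<le> \<nu> (of_nat m)"
proof (induction m)
  case (Suc m)
  then show ?case
    using val_add[of "of_nat m" 1] by (auto simp: val_1 min_def add.commute split: if_splits)
qed (simp add: val_0)

lemma val_const: "c \<noteq> 0 \<Longrightarrow> \<bar>\<nu> [:c:]\<bar> \<noteq> \<infinity>"
proof -
  assume "c \<noteq> 0"
  then have "\<nu> [:c:] + \<nu> [:inverse c:] = 0"
    using val_mult[of "[:c:]" "[:inverse c:]"] by (simp add: val_1 flip: one_pCons)
  then show ?thesis
    by (cases "\<nu> [:c:]"; cases "\<nu> [:inverse c:]") auto
qed

lemma val_power_ge: "ereal c \<le> \<nu> f \<Longrightarrow> ereal (k * c) \<le> \<nu> (f ^ k)"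
proof (induction k)
  case (Suc k)
  then have "ereal c + ereal (k * c) \<le> \<nu> f + \<nu> (f ^ k)"
    by (intro add_mono) auto
  then show ?case
    by (simp add: val_mult algebra_simps)
qed (simp add: val_1)

lemma val_of_nat_mult: "\<nu> f \<le> \<nu> (of_nat m * f)"
  using add_right_mono[OF val_of_nat[of m], of "\<nu> f"] by (simp add: val_mult)

lemma val_mult_power_ge:
  assumes "ereal \<gamma> \<le> \<nu> x"
  shows "\<nu> c + ereal (k * \<gamma>) \<le> \<nu> (c * x ^ k)"
  unfolding val_mult by (intro add_left_mono val_power_ge assms)

lemma val_poly_ge:
  assumes "ereal \<gamma> \<le> \<nu> x" "\<And>j. c \<le> \<nu> (coeff R j) + ereal (j * \<gamma>)"
  shows "c \<le> \<nu> (poly R x)"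
  unfolding poly_altdef
proof (rule val_sum_ge)
  show "c \<le> \<nu> (coeff R j * x ^ j)" for j
    using assms(2)[of j] val_mult_power_ge[OF assms(1)] by (rule order_trans)
qed

lemma val_poly_gt:
  assumes "ereal \<gamma> \<le> \<nu> x" "\<And>j. c < \<nu> (coeff R j) + ereal (j * \<gamma>)" "c < \<infinity>"
  shows "c < \<nu> (poly R x)"
  unfolding poly_altdef
proof (rule val_sum_gt)
  show "c < \<nu> (coeff R j * x ^ j)" for j
    using assms(2)[of j] val_mult_power_ge[OF assms(1)] by (rule less_le_trans)
qed (rule assms(3))

text \<open>The remainder of m modulo p again has positive value if m does, and it is smaller than
  the least positive such integer.\<close>

lemma val_of_nat_pos_iff:
  assumes "residue_char \<nu> > 0"
  shows "0 < \<nu> (of_nat m) \<longleftrightarrow> residue_char \<nu> dvd m"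
proof -
  let ?p = "residue_char \<nu>"
  define P where "P m \<longleftrightarrow> m > 0 \<and> \<nu> (of_nat m) > 0" for m
  have ex: "\<exists>m. P m"
    using assms by (auto simp: residue_char_def P_def split: if_splits)
  then have p_eq: "?p = (LEAST m. P m)"
    by (auto simp: residue_char_def P_def)
  then have p: "0 < \<nu> (of_nat ?p)"
    using LeastI_ex[OF ex] by (simp add: P_def)
  have mult: "0 < \<nu> (of_nat ?p * of_nat k)" for k
    using p val_of_nat[of k] unfolding val_mult
    by (cases "\<nu> (of_nat ?p)"; cases "\<nu> (of_nat k)") auto
  show ?thesis
  proof
    assume m: "0 < \<nu> (of_nat m)"
    have "of_nat m = of_nat ?p * of_nat (m div ?p) + (of_nat (m mod ?p) :: 'a poly)"
      by (metis mult_div_mod_eq of_nat_add of_nat_mult)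
    then have "of_nat (m mod ?p) = of_nat m - of_nat ?p * (of_nat (m div ?p) :: 'a poly)"
      by simp
    then have "0 < \<nu> (of_nat (m mod ?p))"
      using val_diff[of "of_nat m" "of_nat ?p * of_nat (m div ?p)"] m mult[of "m div ?p"]
      by (auto simp: min_def split: if_splits)
    moreover have "m mod ?p < ?p"
      using assms by simp
    ultimately show "?p dvd m"
      using not_less_Least[of "m mod ?p" P] p_eq by (auto simp: P_def)
  qed (use mult in auto)
qed

lemma prime_residue_char:
  assumes "residue_char \<nu> > 0"
  shows "prime (residue_char \<nu>)"
proof -
  let ?p = "residue_char \<nu>"
  have "\<not> ?p dvd 1"
    using val_of_nat_pos_iff[OF assms, of 1] by (simp add: val_1)
  moreover have "?p dvd a \<or> ?p dvd c" if "?p dvd a * c" for a c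
    using that val_of_nat[of a] val_of_nat[of c]
    unfolding val_of_nat_pos_iff[OF assms, symmetric] of_nat_mult val_mult
    by (auto simp: less_le)
  ultimately have "prime_elem ?p"
    unfolding prime_elem_def using assms by blast
  then show ?thesis
    by (rule primeI) simp
qed

text \<open>In residue characteristic 0 take i = 1. Otherwise write j = q r with q the exact power
  of p in j; since j is no power of p, r > 1, and \<open>j choose q\<close> has the same
  p-multiplicity as r, namely 0.\<close>

lemma unit_binomial:
  assumes "1 \<le> j" "j \<notin> (if residue_char \<nu> > 0 then {residue_char \<nu> ^ t | t. True} else {1})"
  shows "\<exists>i. 1 \<le> i \<and> i < j \<and> \<nu> (of_nat (j choose i)) = 0"
proof (cases "residue_char \<nu> > 0")
  case False
  have "\<not> (\<exists>m>0. \<nu> (of_nat m) > 0)"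
  proof
    assume ex: "\<exists>m>0. \<nu> (of_nat m) > 0"
    then have "0 < (LEAST m. 0 < m \<and> \<nu> (of_nat m) > 0)"
      using LeastI_ex[of "\<lambda>m. 0 < m \<and> \<nu> (of_nat m) > 0"] by blast
    then show False
      using False ex by (simp add: residue_char_def)
  qed
  then have "\<nu> (of_nat j) = 0"
    using val_of_nat[of j] assms(1) by (metis le_neq_trans less_eq_Suc_le One_nat_def)
  then show ?thesis
    using assms False by (intro exI[of _ 1]) auto
next
  case True
  let ?p = "residue_char \<nu>"
  have p: "prime ?p"
    using True by (rule prime_residue_char)
  obtain r where r: "j = ?p ^ multiplicity ?p j * r" "\<not> ?p dvd r"
    using multiplicity_decompose'[of j ?p] assms(1) prime_gt_1_nat[OF p] by auto
  let ?q = "?p ^ multiplicity ?p j"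
  have "r > 1"
    using r assms True by (cases "r = 0"; cases "r = 1") auto
  moreover have "?q > 0"
    using True by simp
  ultimately have lt: "?q < j"
    using r(1) by (metis mult.right_neutral mult_less_cancel1)
  have "multiplicity ?p (j choose ?q) = multiplicity ?p r"
    using const_p_fac[of r ?p "multiplicity ?p j"] p r(1) \<open>r > 1\<close> by simp
  also have "\<dots> = 0"
    using r(2) by (rule not_dvd_imp_multiplicity_0)
  finally have "\<not> ?p dvd (j choose ?q)"
    using p lt prime_multiplicity_gt_zero_iff[of ?p "j choose ?q"] by (simp add: prime_imp_prime_elem)
  then have "\<nu> (of_nat (j choose ?q)) = 0"
    using val_of_nat_pos_iff[OF True] val_of_nat[of "j choose ?q"] by (auto simp: less_le)
  then show ?thesis
    using lt \<open>?q > 0\<close> by (intro exI[of _ ?q]) auto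
qed

section \<open>Gauss valuations\<close>

text \<open>The initial form of \<open>P\<close>, for the indeterminate of weight \<open>e\<close>, has value \<open>m\<close> and degree \<open>D\<close>.\<close>

definition ini :: "real \<Rightarrow> 'a poly poly \<Rightarrow> real \<Rightarrow> nat \<Rightarrow> bool" where
  "ini e P m D \<longleftrightarrow>
     (\<forall>b. ereal m \<le> \<nu> (coeff P b) + ereal (b * e)) \<and>
     \<nu> (coeff P D) + ereal (D * e) = ereal m \<and>
     (\<forall>b>D. ereal m < \<nu> (coeff P b) + ereal (b * e))"

text \<open>Initial forms of different degrees cannot cancel. The new degree is D if m < m', and D'
  otherwise, because beyond D all coefficients of P lie strictly above m.\<close>

lemma ini_add:
  assumes "ini e P m D" "ini e R m' D'" "D < D'"
  shows "\<exists>D''. ini e (P + R) (min m m') D''"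
proof -
  have lower: "ereal (min m m') \<le> \<nu> (coeff (P + R) b) + ereal (b * e)" for b
  proof -
    have "ereal m \<le> \<nu> (coeff P b) + ereal (b * e)" "ereal m' \<le> \<nu> (coeff R b) + ereal (b * e)"
      using assms by (auto simp: ini_def)
    then show ?thesis
      using val_add[of "coeff P b" "coeff R b"]
      by (cases "\<nu> (coeff P b)"; cases "\<nu> (coeff R b)"; cases "\<nu> (coeff P b + coeff R b)")
        (auto simp: min_def split: if_splits)
  qed
  have strict: "ereal (min m m') < \<nu> (coeff (P + R) b) + ereal (b * e)"
    if "ereal (min m m') < \<nu> (coeff P b) + ereal (b * e)"
      "ereal (min m m') < \<nu> (coeff R b) + ereal (b * e)" for b
    using that val_add[of "coeff P b" "coeff R b"]
    by (cases "\<nu> (coeff P b)"; cases "\<nu> (coeff R b)"; cases "\<nu> (coeff P b + coeff R b)")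
      (auto simp: min_def split: if_splits)
  have exact: "\<nu> (coeff (P + R) b) + ereal (b * e) = ereal (min m m')"
    if "\<nu> (coeff P b) + ereal (b * e) = ereal (min m m')"
      "ereal (min m m') < \<nu> (coeff R b) + ereal (b * e)" for b
  proof -
    have "\<nu> (coeff P b) < \<nu> (coeff R b)"
      using that by (cases "\<nu> (coeff P b)"; cases "\<nu> (coeff R b)") (auto simp del: ereal_min)
    then show ?thesis
      using that val_add_eq[of "coeff P b" "coeff R b"] by simp
  qed
  have exact': "\<nu> (coeff (P + R) b) + ereal (b * e) = ereal (min m m')"
    if "\<nu> (coeff R b) + ereal (b * e) = ereal (min m m')"
      "ereal (min m m') < \<nu> (coeff P b) + ereal (b * e)" for b
  proof -
    have "\<nu> (coeff R b) < \<nu> (coeff P b)"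
      using that by (cases "\<nu> (coeff P b)"; cases "\<nu> (coeff R b)") (auto simp del: ereal_min)
    then show ?thesis
      using that val_add_eq[of "coeff R b" "coeff P b"] by (simp add: add.commute)
  qed
  show ?thesis
  proof (cases "m < m'")
    case True
    have R: "ereal m < \<nu> (coeff R b) + ereal (b * e)" for b
      using assms(2) True less_le_trans[of "ereal m" "ereal m'"] by (auto simp: ini_def)
    have "ini e (P + R) (min m m') D"
      unfolding ini_def
      using lower strict exact R assms(1) True by (auto simp: ini_def min_def)
    then show ?thesis ..
  next
    case False
    have P: "ereal m' < \<nu> (coeff P b) + ereal (b * e)" if "b > D" for b
      using assms(1) False that le_less_trans[of "ereal m'" "ereal m"] by (auto simp: ini_def)
    have "ini e (P + R) (min m m') D'"
      unfolding ini_def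
      using lower strict exact' P assms(2,3) False by (auto simp: ini_def min_def)
    then show ?thesis ..
  qed
qed

text \<open>Gauss's lemma. Since D and D' are the last indices where the minima are attained,
  exactly one summand of the coefficient at D + D' has the value m + m'; every other one has an
  index beyond D or D'.\<close>

lemma ini_mult:
  assumes "ini e P m D" "ini e R m' D'"
  shows "ini e (P * R) (m + m') (D + D')"
proof -
  let ?t = "\<lambda>b i. coeff P i * coeff R (b - i)"
  have c: "coeff (P * R) b = sum (?t b) {..b}" for b
    by (simp add: coeff_mult)
  have split: "\<nu> (?t b i) + ereal (b * e) =
      (\<nu> (coeff P i) + ereal (i * e)) + (\<nu> (coeff R (b - i)) + ereal (real (b - i) * e))"
    if "i \<le> b" for b i
    using that val_ninf[of "coeff P i"] val_ninf[of "coeff R (b - i)"]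
    by (cases "\<nu> (coeff P i)"; cases "\<nu> (coeff R (b - i))")
      (auto simp: val_mult of_nat_diff algebra_simps)
  have P: "ereal m \<le> \<nu> (coeff P i) + ereal (i * e)"
    and R: "ereal m' \<le> \<nu> (coeff R i) + ereal (i * e)"
    and P': "i > D \<Longrightarrow> ereal m < \<nu> (coeff P i) + ereal (i * e)"
    and R': "i > D' \<Longrightarrow> ereal m' < \<nu> (coeff R i) + ereal (i * e)" for i
    using assms by (auto simp: ini_def)
  have tlow: "ereal (m + m') \<le> \<nu> (?t b i) + ereal (b * e)" if "i \<le> b" for b i
    unfolding split[OF that] using add_mono[OF P[of i] R[of "b - i"]] by (simp only: plus_ereal.simps)
  have tstrict: "ereal (m + m') < \<nu> (?t b i) + ereal (b * e)"
    if "i \<le> b" "i > D \<or> b - i > D'" for b i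
    unfolding split[OF that(1)]
    using that(2) P[of i] R[of "b - i"] P'[of i] R'[of "b - i"]
    by (cases "\<nu> (coeff P i)"; cases "\<nu> (coeff R (b - i))") auto
  \<comment> \<open>The weight is real, so it can be moved across and the bounds for sums apply to
    \<nu> alone.\<close>
  have shift: "c \<le> x + ereal r \<longleftrightarrow> c - ereal r \<le> x" "c < x + ereal r \<longleftrightarrow> c - ereal r < x"
    for c x :: ereal and r
    by (cases c; cases x; auto)+
  have 1: "ereal (m + m') \<le> \<nu> (coeff (P * R) b) + ereal (b * e)" for b
    unfolding c shift(1) by (rule val_sum_ge) (use tlow in \<open>auto simp: shift(1)\<close>)
  have 2: "ereal (m + m') < \<nu> (coeff (P * R) b) + ereal (b * e)" if "b > D + D'" for b
    unfolding c shift(2)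
  proof (rule val_sum_gt)
    fix i assume "i \<in> {..b}"
    then show "ereal (m + m') - ereal (b * e) < \<nu> (?t b i)"
      unfolding shift(2)[symmetric] using that by (intro tstrict) auto
  qed simp
  have ex: "\<nu> (?t (D + D') D) + ereal ((D + D') * e) = ereal (m + m')"
    using assms split[of D "D + D'"] by (simp add: ini_def)
  have rest: "ereal (m + m') < \<nu> (sum (?t (D + D')) ({..D + D'} - {D})) + ereal ((D + D') * e)"
    unfolding shift(2)
  proof (rule val_sum_gt)
    fix i assume "i \<in> {..D + D'} - {D}"
    then show "ereal (m + m') - ereal ((D + D') * e) < \<nu> (?t (D + D') i)"
      unfolding shift(2)[symmetric] by (intro tstrict) auto
  qed simp
  have "coeff (P * R) (D + D') =
      ?t (D + D') D + sum (?t (D + D')) ({..D + D'} - {D})"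
    unfolding c by (rule sum.remove) auto
  moreover have "\<nu> (?t (D + D') D) < \<nu> (sum (?t (D + D')) ({..D + D'} - {D}))"
    using ex rest
    by (cases "\<nu> (?t (D + D') D)"; cases "\<nu> (sum (?t (D + D')) ({..D + D'} - {D}))") auto
  ultimately have "\<nu> (coeff (P * R) (D + D')) + ereal ((D + D') * e) = ereal (m + m')"
    using ex val_add_eq by simp
  then show ?thesis
    using 1 2 by (auto simp: ini_def)
qed

text \<open>A nonzero polynomial may have value \<infinity>, so the minimum is taken over the
  coefficients of finite value rather than over the nonzero ones.\<close>

lemma ini_exists:
  assumes "\<nu> (coeff P b0) \<noteq> \<infinity>"
  shows "\<exists>m D. ini e P m D"
proof -
  define S where "S = {b. \<nu> (coeff P b) \<noteq> \<infinity>}"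
  define g where "g b = real_of_ereal (\<nu> (coeff P b)) + b * e" for b
  have "S \<subseteq> {..degree P}"
    using coeff_eq_0[of P] by (auto simp: S_def val_0 intro: leI)
  then have fin: "finite S"
    by (rule finite_subset) simp
  have ne: "S \<noteq> {}"
    using assms by (auto simp: S_def)
  have g: "\<nu> (coeff P b) + ereal (b * e) = ereal (g b)" if "b \<in> S" for b
    using that val_ninf[of "coeff P b"] by (cases "\<nu> (coeff P b)") (auto simp: S_def g_def)
  have inf: "\<nu> (coeff P b) + ereal (b * e) = \<infinity>" if "b \<notin> S" for b
    using that by (auto simp: S_def)
  define m where "m = Min (g ` S)"
  define A where "A = {b \<in> S. g b = m}"
  have "m \<in> g ` S"
    unfolding m_def using fin ne by (intro Min_in) auto
  then have A: "finite A" "A \<noteq> {}"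
    using fin by (auto simp: A_def)
  have D: "Max A \<in> A"
    using A by (rule Max_in)
  have mle: "m \<le> g b" if "b \<in> S" for b
    using that fin by (auto simp: m_def)
  have "ini e P m (Max A)"
    unfolding ini_def
  proof (intro conjI allI impI)
    show "ereal m \<le> \<nu> (coeff P b) + ereal (b * e)" for b
      using mle g inf by (cases "b \<in> S") auto
    show "\<nu> (coeff P (Max A)) + ereal (Max A * e) = ereal m"
      using D g by (auto simp: A_def)
    show "ereal m < \<nu> (coeff P b) + ereal (b * e)" if "Max A < b" for b
    proof (cases "b \<in> S")
      case True
      have "b \<notin> A"
        using that A(1) by (meson Max_ge leD)
      then show ?thesis
        using True mle[of b] g by (auto simp: A_def)
    qed (simp add: inf)
  qed
  then show ?thesis by blast
qed

definition gauss :: "real \<Rightarrow> 'a poly \<Rightarrow> ereal" where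
  "gauss e f = (INF b. \<nu> (hasse b f) + ereal (b * e))"

lemma gauss_ge_iff: "c \<le> gauss e f \<longleftrightarrow> (\<forall>b. c \<le> \<nu> (hasse b f) + ereal (b * e))"
  by (simp add: gauss_def le_INF_iff)

lemma gauss_le: "gauss e f \<le> \<nu> (hasse b f) + ereal (b * e)"
  unfolding gauss_def by (rule INF_lower) simp

lemma gauss_le_val: "gauss e f \<le> \<nu> f"
  using gauss_le[of e f 0] by simp

lemma gauss_mono: "e \<le> e' \<Longrightarrow> gauss e f \<le> gauss e' f"
  unfolding gauss_def by (intro INF_mono) (metis UNIV_I add_left_mono ereal_less_eq(3) mult_left_mono of_nat_0_le_iff)

lemma gauss_eq_ini: "ini e (taylor f) m D \<Longrightarrow> gauss e f = ereal m"
  using gauss_le[of e f D]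
  by (intro antisym) (auto simp: gauss_ge_iff ini_def coeff_taylor)

lemma gauss_0: "gauss e 0 = \<infinity>"
  by (simp add: gauss_def val_0)

text \<open>The top Hasse derivative is a nonzero constant. Hence \<open>gauss e f\<close> is finite
  for every nonzero f, even where \<nu> is infinite.\<close>

lemma val_hasse_degree: "f \<noteq> 0 \<Longrightarrow> \<bar>\<nu> (hasse (degree f) f)\<bar> \<noteq> \<infinity>"
  by (simp add: hasse_degree val_const)

lemma ini_taylor_exists:
  assumes "f \<noteq> 0"
  shows "\<exists>m D. ini e (taylor f) m D"
  using val_hasse_degree[OF assms] by (intro ini_exists[of _ "degree f"]) (auto simp: coeff_taylor)

lemma gauss_finite: "f \<noteq> 0 \<Longrightarrow> \<bar>gauss e f\<bar> \<noteq> \<infinity>"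
  using ini_taylor_exists[of f e] gauss_eq_ini by fastforce

lemma gauss_valuation: "rank_one_valuation (gauss e)"
  unfolding rank_one_valuation_def
proof (intro conjI allI)
  fix f g
  have ninf: "gauss e f \<noteq> -\<infinity>" for f
    using gauss_finite[of f e] gauss_0[of e] by (cases "f = 0") auto
  then show "gauss e f \<noteq> -\<infinity>" .
  show "gauss e (f * g) = gauss e f + gauss e g"
  proof (cases "f = 0 \<or> g = 0")
    case True
    then show ?thesis
      using ninf[of f] ninf[of g] by (auto simp: gauss_0)
  next
    case False
    then obtain m D m' D' where i: "ini e (taylor f) m D" "ini e (taylor g) m' D'"
      using ini_taylor_exists by meson
    show ?thesis
      using gauss_eq_ini[of e "f * g", unfolded taylor_mult, OF ini_mult[OF i]]
        gauss_eq_ini[OF i(1)] gauss_eq_ini[OF i(2)] by simp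
  qed
  show "min (gauss e f) (gauss e g) \<le> gauss e (f + g)"
    unfolding gauss_ge_iff
  proof
    fix b
    have "min (gauss e f) (gauss e g)
        \<le> min (\<nu> (hasse b f) + ereal (b * e)) (\<nu> (hasse b g) + ereal (b * e))"
      by (intro min.mono gauss_le)
    also have "\<dots> \<le> \<nu> (hasse b (f + g)) + ereal (b * e)"
      using val_add[of "hasse b f" "hasse b g"]
      by (cases "\<nu> (hasse b f)"; cases "\<nu> (hasse b g)"; cases "\<nu> (hasse b f + hasse b g)")
        (auto simp: hasse_add min_def split: if_splits)
    finally show "min (gauss e f) (gauss e g) \<le> \<nu> (hasse b (f + g)) + ereal (b * e)" .
  qed
  show "gauss e 0 = \<infinity>"
    by (rule gauss_0)
  have h: "hasse b 1 = (if b = 0 then 1 else 0)" for b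
    by (simp add: hasse_eq_0)
  have "ini e (taylor 1) 0 0"
    by (simp add: ini_def coeff_taylor h val_0 val_1)
  then show "gauss e 1 = 0"
    using gauss_eq_ini by (fastforce simp: zero_ereal_def)
qed


text \<open>The right side says that the initial form at level e is constant in y. The clause on
  \<infinity> is needed because a nonconstant f with \<nu> f = \<infinity> has \<open>eps\<close>
  equal to \<infinity>.\<close>

lemma eps_lt_iff:
  assumes "f \<noteq> 0"
  shows "eps \<nu> f < ereal e \<longleftrightarrow> \<nu> f \<noteq> \<infinity> \<and> (\<forall>b>0. \<nu> f < \<nu> (hasse b f) + ereal (b * e))"
proof (cases "degree f = 0")
  case True
  then obtain c where "f = [:c:]"
    by (rule degree_eq_zeroE)
  then show ?thesis
    using True assms val_const[of c] by (auto simp: eps_def hasse_eq_0 val_0)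
next
  case False
  have q: "(\<nu> f - \<nu> (hasse b f)) / ereal (real b) < ereal e \<longleftrightarrow>
      \<nu> f \<noteq> \<infinity> \<and> \<nu> f < \<nu> (hasse b f) + ereal (b * e)" if "b > 0" for b
    using that val_ninf[of f] val_ninf[of "hasse b f"]
    by (cases "\<nu> f"; cases "\<nu> (hasse b f)") (auto simp: field_simps)
  have out: "\<nu> f < \<nu> (hasse b f) + ereal (b * e)" if "b > degree f" "\<nu> f \<noteq> \<infinity>" for b
    using that by (simp add: hasse_eq_0 val_0 less_top top_ereal_def)
  have "eps \<nu> f < ereal e \<longleftrightarrow>
      (\<forall>b\<in>{1..degree f}. (\<nu> f - \<nu> (hasse b f)) / ereal (real b) < ereal e)"
    using False by (auto simp: eps_def Max_less_iff)
  also have "\<dots> \<longleftrightarrow> \<nu> f \<noteq> \<infinity> \<and> (\<forall>b>0. \<nu> f < \<nu> (hasse b f) + ereal (b * e))"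
  proof safe
    assume *: "\<forall>b\<in>{1..degree f}. (\<nu> f - \<nu> (hasse b f)) / ereal (real b) < ereal e"
    show **: False if "\<nu> f = \<infinity>"
      using * q[of 1] False that by auto
    show "\<nu> f < \<nu> (hasse b f) + ereal (b * e)" if "b > 0" for b
      using * q[of b] out[of b] ** that by (cases "b \<le> degree f") auto
  next
    fix b
    assume "\<forall>b>0. \<nu> f < \<nu> (hasse b f) + ereal (b * e)" "b \<in> {1..degree f}" "\<nu> f \<noteq> \<infinity>"
    then show "(\<nu> f - \<nu> (hasse b f)) / ereal (real b) < ereal e"
      using q[of b] by auto
  qed
  finally show ?thesis .
qed

lemma gauss_eq_val_iff: "gauss e f = \<nu> f \<longleftrightarrow> eps \<nu> f \<le> ereal e"
proof (cases "degree f = 0")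
  case True
  then have "\<nu> f \<le> \<nu> (hasse b f) + ereal (b * e)" for b
    by (cases "b = 0") (auto simp: hasse_eq_0 val_0)
  then have "gauss e f = \<nu> f"
    by (intro antisym gauss_le_val) (simp add: gauss_ge_iff)
  then show ?thesis
    using True by (simp add: eps_def)
next
  case False
  then have f: "f \<noteq> 0"
    by auto
  show ?thesis
  proof (cases "\<nu> f = \<infinity>")
    case True
    have "gauss e f \<noteq> \<nu> f"
      using gauss_finite[OF f, of e] True by auto
    \<comment> \<open>The strict criterion at any level above e already excludes
      \<open>eps \<nu> f \<le> ereal e\<close>.\<close>
    moreover have "\<not> eps \<nu> f < ereal (e + 1)"
      using True eps_lt_iff[OF f] by simp
    then have "\<not> eps \<nu> f \<le> ereal e"
      using le_less_trans[of "eps \<nu> f" "ereal e" "ereal (e + 1)"] by auto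
    ultimately show ?thesis by simp
  next
    case fin: False
    have q: "(\<nu> f - \<nu> (hasse b f)) / ereal (real b) \<le> ereal e \<longleftrightarrow>
        \<nu> f \<le> \<nu> (hasse b f) + ereal (b * e)" if "b > 0" for b
      using that val_ninf[of f] val_ninf[of "hasse b f"] fin
      by (cases "\<nu> f"; cases "\<nu> (hasse b f)") (auto simp: field_simps)
    have "gauss e f = \<nu> f \<longleftrightarrow> (\<forall>b. \<nu> f \<le> \<nu> (hasse b f) + ereal (b * e))"
      using gauss_le_val[of e f] gauss_ge_iff[of "\<nu> f" e f] by (auto intro: antisym)
    also have "\<dots> \<longleftrightarrow> (\<forall>b\<in>{1..degree f}. \<nu> f \<le> \<nu> (hasse b f) + ereal (b * e))"
    proof
      assume *: "\<forall>b\<in>{1..degree f}. \<nu> f \<le> \<nu> (hasse b f) + ereal (b * e)"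
      show "\<forall>b. \<nu> f \<le> \<nu> (hasse b f) + ereal (b * e)"
      proof
        fix b
        show "\<nu> f \<le> \<nu> (hasse b f) + ereal (b * e)"
        proof (cases "b \<in> {1..degree f}")
          case False
          then have "b = 0 \<or> b > degree f"
            by auto
          then show ?thesis
            by (auto simp: hasse_eq_0 val_0)
        qed (use * in auto)
      qed
    qed auto
    also have "\<dots> \<longleftrightarrow> eps \<nu> f \<le> ereal e"
      using False q by (auto simp: eps_def Max_le_iff)
    finally show ?thesis .
  qed
qed

lemma ini_taylor_small:
  assumes "f \<noteq> 0" "eps \<nu> f < ereal e"
  obtains m where "\<nu> f = ereal m" "ini e (taylor f) m 0"
proof -
  from assms eps_lt_iff have *: "\<nu> f \<noteq> \<infinity>" "\<forall>b>0. \<nu> f < \<nu> (hasse b f) + ereal (b * e)"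
    by auto
  then obtain m where m: "\<nu> f = ereal m"
    using val_ninf[of f] by (cases "\<nu> f") auto
  have "ereal m \<le> \<nu> (hasse b f) + ereal (b * e)" for b
    using * m by (cases "b = 0") (auto simp: less_imp_le)
  then have "ini e (taylor f) m 0"
    using * m by (auto simp: ini_def coeff_taylor)
  with m show ?thesis by (rule that)
qed

lemma ini_taylor_large:
  assumes "f \<noteq> 0" "ereal e \<le> eps \<nu> f" "ini e (taylor f) m D"
  shows "D > 0"
proof (rule ccontr)
  assume "\<not> D > 0"
  then have "\<nu> f = ereal m" "\<forall>b>0. ereal m < \<nu> (hasse b f) + ereal (b * e)"
    using assms(3) by (auto simp: ini_def coeff_taylor)
  then show False
    using eps_lt_iff[OF assms(1), of e] assms(2) by auto
qed

text \<open>As a function of the level, \<open>gauss\<close> is a minimum of lines of slopes b. At e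
  the minimum is attained on a line of slope D with D \<ge> 1, and following this line back to e0
  loses at least e - e0.\<close>

lemma gauss_gap:
  assumes "f \<noteq> 0" "ereal e \<le> eps \<nu> f" "e0 \<le> e"
  shows "gauss e0 f + ereal (e - e0) \<le> gauss e f"
proof -
  obtain m D where i: "ini e (taylor f) m D"
    using ini_taylor_exists[OF assms(1)] by blast
  have D: "D \<ge> 1"
    using ini_taylor_large[OF assms(1,2) i] by simp
  have "gauss e0 f \<le> \<nu> (hasse D f) + ereal (D * e0)"
    by (rule gauss_le)
  also have "\<nu> (hasse D f) + ereal (D * e0) = ereal (m - D * (e - e0))"
    using i by (cases "\<nu> (hasse D f)") (auto simp: ini_def coeff_taylor algebra_simps)
  also have "\<dots> \<le> ereal (m - (e - e0))"
    using mult_right_mono[of 1 "real D" "e - e0"] D assms(3) by simp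
  finally show ?thesis
    using gauss_eq_ini[OF i] by (cases "gauss e0 f") auto
qed

text \<open>The initial form of \<open>a\<close> is constant, that of \<open>Q * g\<close> is not, so they cannot cancel.\<close>

lemma gauss_expansion_step:
  assumes "Q \<noteq> 0" "ereal e \<le> eps \<nu> Q" "a = 0 \<or> eps \<nu> a < ereal e"
  shows "gauss e (a + Q * g) = min (\<nu> a) (gauss e Q + gauss e g)"
proof -
  have ge: "gauss e a = \<nu> a"
    using assms(3) by (auto simp: gauss_0 val_0) (simp add: gauss_eq_val_iff less_imp_le)
  have mult: "gauss e Q + gauss e g = gauss e (Q * g)"
    using gauss_valuation by (simp add: rank_one_valuation_def)
  show ?thesis
  proof (cases "a = 0 \<or> g = 0")
    case True
    then show ?thesis
      unfolding mult ge[symmetric] by (auto simp: gauss_0)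
  next
    case False
    then obtain m where m: "\<nu> a = ereal m" "ini e (taylor a) m 0"
      using ini_taylor_small[of a] assms(3) by auto
    obtain m' D' where Q: "ini e (taylor Q) m' D'"
      using ini_taylor_exists[OF assms(1)] by blast
    obtain m'' D'' where g: "ini e (taylor g) m'' D''"
      using ini_taylor_exists False by blast
    have Qg: "ini e (taylor (Q * g)) (m' + m'') (D' + D'')"
      unfolding taylor_mult by (rule ini_mult[OF Q g])
    have "D' > 0"
      using ini_taylor_large[OF assms(1,2) Q] .
    then obtain D where "ini e (taylor (a + Q * g)) (min m (m' + m'')) D"
      using ini_add[OF m(2) Qg] by (auto simp: taylor_add)
    then show ?thesis
      unfolding mult using gauss_eq_ini gauss_eq_ini[OF Qg] m(1) by fastforce
  qed
qed

lemma gauss_poly_valuation: "poly_valuation (gauss e)"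
  by unfold_locales (rule gauss_valuation)

text \<open>Horner's scheme over \<open>gauss_expansion_step\<close>. The level e may lie below
  \<open>eps \<nu> Q\<close>: this is what bounds the coefficients of an expansion in a later key
  polynomial at an earlier truncation.\<close>

lemma gauss_poly_le:
  assumes "Q \<noteq> 0" "ereal e \<le> eps \<nu> Q" "gauss e Q = ereal \<gamma>"
    and "\<And>j. coeff R j = 0 \<or> eps \<nu> (coeff R j) < ereal e"
  shows "gauss e (poly R Q) \<le> \<nu> (coeff R j) + ereal (j * \<gamma>)"
  using assms(4)
proof (induction R arbitrary: j)
  case 0
  then show ?case by (simp add: val_0)
next
  case (pCons a R)
  have R: "coeff R j = 0 \<or> eps \<nu> (coeff R j) < ereal e" for j
    using pCons.prems[of "Suc j"] by simp
  have step: "gauss e (poly (pCons a R) Q) = min (\<nu> a) (ereal \<gamma> + gauss e (poly R Q))"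
    using gauss_expansion_step[OF assms(1,2), of a "poly R Q"] pCons.prems[of 0] assms(3) by simp
  show ?case
  proof (cases j)
    case 0
    then show ?thesis
      unfolding step by simp
  next
    case (Suc k)
    have "ereal \<gamma> + gauss e (poly R Q) \<le> ereal \<gamma> + (\<nu> (coeff R k) + ereal (k * \<gamma>))"
      by (intro add_left_mono pCons.IH R)
    also have "\<dots> = \<nu> (coeff R k) + ereal (Suc k * \<gamma>)"
      by (cases "\<nu> (coeff R k)") (auto simp: algebra_simps)
    finally show ?thesis
      unfolding step Suc by (simp add: min.coboundedI2)
  qed
qed

text \<open>Here a difference of levels becomes a gain in value. Absence of cancellation at e0
  bounds \<open>gauss e0 f\<close> by the value of \<open>Q * (f div Q)\<close>; raising the level
  to e gains e - e0 on the factor Q and loses nothing on the other.\<close>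

lemma gauss_mod_gap:
  assumes "Q \<noteq> 0" "ereal e \<le> eps \<nu> Q" "e0 \<le> e"
    and "f mod Q = 0 \<or> eps \<nu> (f mod Q) < ereal e0"
  shows "gauss e0 f + ereal (e - e0) \<le> gauss e (f - f mod Q)"
proof -
  have "ereal e0 \<le> eps \<nu> Q"
    using order_trans[OF _ assms(2)] assms(3) by simp
  from gauss_expansion_step[OF assms(1) this assms(4), of "f div Q"]
  have "gauss e0 f \<le> gauss e0 Q + gauss e0 (f div Q)"
    by simp
  then have "gauss e0 f + ereal (e - e0) \<le> gauss e0 Q + gauss e0 (f div Q) + ereal (e - e0)"
    by (rule add_right_mono)
  also have "\<dots> = (gauss e0 Q + ereal (e - e0)) + gauss e0 (f div Q)"
    by (simp add: ac_simps)
  also have "\<dots> \<le> gauss e Q + gauss e (f div Q)"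
    by (intro add_mono gauss_gap gauss_mono assms)
  also have "\<dots> = gauss e (f - f mod Q)"
    using gauss_valuation by (simp add: rank_one_valuation_def minus_mod_eq_mult_div)
  finally show ?thesis .
qed

end

section \<open>Expansions in powers of a polynomial\<close>

lemma poly_eq_sum_le:
  fixes p :: "'a::comm_ring_1 poly"
  assumes "degree p \<le> N"
  shows "poly p x = (\<Sum>i\<le>N. coeff p i * x ^ i)"
  unfolding poly_altdef
  by (rule sum.mono_neutral_left) (use assms in \<open>auto simp: coeff_eq_0\<close>)

lemma coeff_qexp: "coeff (qexp Q f) i = (if i \<le> degX Q f then qcoeff Q f i else 0)"
  by (simp add: qexp_def coeff_Poly_eq nth_default_def less_Suc_eq_le del: upt_Suc)

lemma degree_mod_lt: "0 < degree Q \<Longrightarrow> degree (f mod Q) < degree (Q :: 'a::field poly)"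
  using degree_mod_less[of Q f] by (cases "Q = 0") auto

lemma degree_qcoeff: "0 < degree Q \<Longrightarrow> degree (qcoeff Q f i) < degree Q"
  by (simp add: qcoeff_def degree_mod_lt)

lemma poly_qexp:
  assumes "0 < degree Q"
  shows "poly (qexp Q f) Q = f"
proof -
  have Q: "Q \<noteq> 0"
    using assms by auto
  \<comment> \<open>Repeated division by Q: what remains after N steps is a multiple of
    \<open>Q ^ N\<close>, and it vanishes for N = \<open>Suc (degX Q f)\<close>.\<close>
  have partial: "(\<Sum>i<N. qcoeff Q f i * Q ^ i) = f - (f div Q ^ N) * Q ^ N" for N
  proof (induction N)
    case (Suc N)
    have "f div Q ^ N = (f div Q ^ N) div Q * Q + qcoeff Q f N"
      by (simp add: qcoeff_def)
    also have "(f div Q ^ N) div Q = f div Q ^ Suc N"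
      by (simp add: power_Suc2 poly_div_mult_right del: power_Suc)
    finally have "(f div Q ^ N) * Q ^ N = (f div Q ^ Suc N * Q + qcoeff Q f N) * Q ^ N"
      by (rule arg_cong)
    then show ?case
      using Suc by (simp add: algebra_simps)
  qed simp
  have "degree f < Suc (degX Q f) * degree Q"
    using dividend_less_div_times[OF assms, of "degree f"] by (simp add: degX_def)
  then have "f div Q ^ Suc (degX Q f) = 0"
    using Q by (intro div_poly_less) (simp add: degree_power_eq degree_mult_eq)
  then have "(\<Sum>i\<le>degX Q f. qcoeff Q f i * Q ^ i) = f"
    using partial[of "Suc (degX Q f)"] by (simp add: lessThan_Suc_atMost)
  moreover have "degree (qexp Q f) \<le> degX Q f"
    by (rule degree_le) (simp add: coeff_qexp)
  ultimately show ?thesis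
    by (simp add: poly_eq_sum_le coeff_qexp)
qed

section \<open>Key polynomials of fixed degree\<close>

locale plateau = poly_valuation +
  fixes n :: nat
  assumes n_pos: "1 \<le> n"
    and bounded: "\<exists>a. \<forall>Q'\<in>Psi \<nu> n. \<nu> Q' < \<nu> a"
    and no_max: "\<not> (\<exists>Q1\<in>Psi \<nu> n. \<forall>Q'\<in>Psi \<nu> n. \<nu> Q' \<le> \<nu> Q1)"
begin

definition val_of :: "'a poly \<Rightarrow> real" where "val_of f = real_of_ereal (\<nu> f)"

definition eps_of :: "'a poly \<Rightarrow> real" where "eps_of f = real_of_ereal (eps \<nu> f)"

abbreviation trunc :: "'a poly \<Rightarrow> 'a poly \<Rightarrow> ereal" where "trunc Q \<equiv> gauss (eps_of Q)"

lemma trunc_poly_valuation: "poly_valuation (trunc Q)"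
  by (rule gauss_poly_valuation)

context
  fixes Q assumes Q: "Q \<in> Psi \<nu> n"
begin

lemma psi_degree: "degree Q = n"
  and psi_lead: "lead_coeff Q = 1"
  using Q by (auto simp: Psi_def key_poly_def)

lemma psi_nonzero: "Q \<noteq> 0"
  using psi_lead by auto

lemma psi_val: "\<nu> Q = ereal (val_of Q)"
  using bounded Q val_ninf[of Q] by (cases "\<nu> Q") (auto simp: val_of_def)

lemma psi_eps: "eps \<nu> Q = ereal (eps_of Q)"
proof -
  have n: "degree Q \<noteq> 0"
    using n_pos psi_degree by simp
  have "eps \<nu> Q \<in> (\<lambda>b. (\<nu> Q - \<nu> (hasse b Q)) / ereal (real b)) ` {1..degree Q}"
    using n unfolding eps_def by (auto intro!: Max_in)
  then obtain b where "b \<ge> 1" "eps \<nu> Q = (\<nu> Q - \<nu> (hasse b Q)) / ereal (real b)"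
    by auto
  then have "eps \<nu> Q \<noteq> \<infinity>"
    using val_ninf[of "hasse b Q"] psi_val by (cases "\<nu> (hasse b Q)") auto
  \<comment> \<open>For monic Q the n-th Hasse derivative is 1, so the index b = n alone forces
    \<open>eps \<nu> Q\<close> to be at least \<nu>(Q)/n.\<close>
  moreover have "\<nu> (hasse n Q) = 0"
    using hasse_degree[of Q] psi_lead psi_degree val_1 by (simp add: one_pCons)
  then have "\<not> eps \<nu> Q < ereal (val_of Q / n)"
    unfolding eps_lt_iff[OF psi_nonzero] using n_pos psi_val
    by (intro notI, elim conjE allE[of _ n]) simp
  then have "eps \<nu> Q \<noteq> -\<infinity>"
    by auto
  ultimately show ?thesis
    by (cases "eps \<nu> Q") (auto simp: eps_of_def)
qed

lemma eps_small: "degree a < n \<Longrightarrow> eps \<nu> a < ereal (eps_of Q)"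
proof (rule ccontr)
  assume "degree a < n" "\<not> eps \<nu> a < ereal (eps_of Q)"
  then show False
    using Q psi_eps by (simp add: Psi_def key_poly_def not_less) (meson leD)
qed

lemma val_small: "degree a < n \<Longrightarrow> a \<noteq> 0 \<Longrightarrow> \<nu> a = ereal (val_of a)"
  by (rule ini_taylor_small[of a "eps_of Q"]) (auto simp: eps_small val_of_def)

lemma trunc_small: "degree a < n \<Longrightarrow> trunc Q a = \<nu> a"
  using eps_small by (simp add: gauss_eq_val_iff less_imp_le)

lemma trunc_self: "trunc Q Q = ereal (val_of Q)"
  using psi_eps psi_val gauss_eq_val_iff[of "eps_of Q" Q] by simp

text \<open>One inequality is the absence of cancellation in \<open>gauss_poly_le\<close>, the other
  the ultrametric inequality for the Gauss valuation.\<close>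

lemma trunc_val_eq: "trunc_val \<nu> Q f = trunc Q f"
proof -
  interpret t: poly_valuation "trunc Q"
    by (rule trunc_poly_valuation)
  let ?d = "degX Q f"
  let ?L = "qexp Q f"
  have pos: "0 < degree Q"
    using n_pos psi_degree by simp
  have small: "degree (coeff ?L j) < n" for j
    using degree_qcoeff[OF pos, of f j] n_pos psi_degree by (auto simp: coeff_qexp)
  have value_term: "\<nu> (qcoeff Q f i * Q ^ i) = \<nu> (qcoeff Q f i) + ereal (i * val_of Q)" for i
  proof -
    have "\<nu> (Q ^ i) = ereal (i * val_of Q)"
      by (induction i) (auto simp: val_1 val_mult psi_val algebra_simps)
    then show ?thesis
      by (simp add: val_mult)
  qed
  have "trunc Q (poly ?L Q) \<le> \<nu> (coeff ?L j) + ereal (j * val_of Q)" for j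
    using eps_small small by (intro gauss_poly_le) (auto simp: psi_nonzero psi_eps trunc_self)
  then have 1: "trunc Q f \<le> \<nu> (qcoeff Q f j * Q ^ j)" if "j \<le> ?d" for j
    using that poly_qexp[OF pos, of f] unfolding value_term by (metis coeff_qexp)
  have "trunc_val \<nu> Q f \<le> trunc Q (poly ?L Q)"
  proof (rule t.val_poly_ge)
    show "ereal (val_of Q) \<le> trunc Q Q"
      by (simp add: trunc_self)
    show "trunc_val \<nu> Q f \<le> trunc Q (coeff ?L j) + ereal (j * val_of Q)" for j
    proof (cases "j \<le> ?d")
      case True
      then have "trunc_val \<nu> Q f \<le> \<nu> (qcoeff Q f j * Q ^ j)"
        by (auto simp: trunc_val_def)
      also have "\<dots> = trunc Q (coeff ?L j) + ereal (j * val_of Q)"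
        unfolding value_term trunc_small[OF small] using True by (simp add: coeff_qexp)
      finally show ?thesis .
    next
      case False
      then show ?thesis
        by (simp add: coeff_qexp gauss_0)
    qed
  qed
  then have 2: "trunc_val \<nu> Q f \<le> trunc Q f"
    by (simp add: poly_qexp[OF pos])
  have "trunc Q f \<le> trunc_val \<nu> Q f"
    using 1 by (auto simp: trunc_val_def)
  with 2 show ?thesis
    by simp
qed

end

lemma psi_degree_diff:
  assumes "Q \<in> Psi \<nu> n" "Q' \<in> Psi \<nu> n"
  shows "degree (Q - Q') < n"
proof (cases "Q = Q'")
  case False
  have "coeff (Q - Q') n = 0"
    using psi_lead[OF assms(1)] psi_lead[OF assms(2)] psi_degree[OF assms(1)] psi_degree[OF assms(2)]
    by simp
  moreover have "degree (Q - Q') \<le> n"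
    using psi_degree[OF assms(1)] psi_degree[OF assms(2)] by (simp add: degree_diff_le)
  ultimately show ?thesis
    using False leading_coeff_0_iff[of "Q - Q'"] by (cases "degree (Q - Q') = n") auto
qed (use n_pos in simp)

lemma trunc_psi:
  assumes "Q \<in> Psi \<nu> n" "Q' \<in> Psi \<nu> n"
  shows "trunc Q Q' = min (\<nu> (Q' - Q)) (\<nu> Q)"
proof -
  interpret t: poly_valuation "trunc Q"
    by (rule trunc_poly_valuation)
  have "trunc Q ((Q' - Q) + Q * 1) = min (\<nu> (Q' - Q)) (trunc Q Q + trunc Q 1)"
    using assms psi_degree_diff
    by (intro gauss_expansion_step) (auto simp: psi_nonzero psi_eps eps_small)
  then show ?thesis
    using assms by (simp add: t.val_1 trunc_self psi_val)
qed

lemma trunc_later: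
  assumes "Q \<in> Psi \<nu> n" "Q' \<in> Psi \<nu> n" "\<nu> Q \<le> \<nu> Q'"
  shows "trunc Q Q' = ereal (val_of Q)"
  using trunc_psi[OF assms(1,2)] val_diff[of Q' Q] assms psi_val[OF assms(1)]
  by (auto simp: min_def split: if_splits)

text \<open>Both sides are equivalent to \<open>trunc Q Q' < \<nu> Q'\<close>. Thus ordering key
  polynomials of degree n by value or by level is the same.\<close>

lemma eps_of_less_iff:
  assumes "Q \<in> Psi \<nu> n" "Q' \<in> Psi \<nu> n"
  shows "eps_of Q < eps_of Q' \<longleftrightarrow> \<nu> Q < \<nu> Q'"
proof
  assume "\<nu> Q < \<nu> Q'"
  then have "trunc Q Q' < \<nu> Q'"
    using trunc_psi[OF assms] by (auto simp: min_def)
  then have "\<not> eps \<nu> Q' \<le> ereal (eps_of Q)"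
    using gauss_eq_val_iff[of "eps_of Q" Q'] by auto
  then show "eps_of Q < eps_of Q'"
    by (simp add: psi_eps[OF assms(2)])
next
  assume "eps_of Q < eps_of Q'"
  then have "trunc Q Q' \<noteq> \<nu> Q'"
    using gauss_eq_val_iff[of "eps_of Q" Q'] psi_eps[OF assms(2)] by auto
  then have "trunc Q Q' < \<nu> Q'"
    using gauss_le_val[of "eps_of Q" Q'] by auto
  then show "\<nu> Q < \<nu> Q'"
    using trunc_psi[OF assms] val_diff[of Q' Q] by (auto simp: min_def split: if_splits)
qed

lemma trunc_mono:
  assumes "Q \<in> Psi \<nu> n" "Q' \<in> Psi \<nu> n" "\<nu> Q \<le> \<nu> Q'"
  shows "trunc Q f \<le> trunc Q' f"
  using eps_of_less_iff[OF assms(2,1)] assms(3) by (intro gauss_mono) auto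

lemma psi_above:
  assumes "finite A" "A \<subseteq> Psi \<nu> n" "A \<noteq> {}"
  shows "\<exists>Q'\<in>Psi \<nu> n. \<forall>Q\<in>A. \<nu> Q < \<nu> Q'"
proof -
  have "Max (\<nu> ` A) \<in> \<nu> ` A"
    using assms by (intro Max_in) auto
  then obtain Q1 where Q1: "Q1 \<in> A" "\<nu> Q1 = Max (\<nu> ` A)"
    by auto
  then obtain Q' where Q': "Q' \<in> Psi \<nu> n" "\<nu> Q1 < \<nu> Q'"
    using no_max assms(2) by (meson not_le subsetD)
  have "\<nu> Q \<le> \<nu> Q1" if "Q \<in> A" for Q
    using that assms(1) Q1(2) by simp
  with Q' show ?thesis
    by (meson le_less_trans)
qed

lemma S_set_iff: "f \<in> S_set \<nu> n \<longleftrightarrow> (\<forall>Q\<in>Psi \<nu> n. trunc Q f < \<nu> f)"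
  by (simp add: S_set_def trunc_val_eq)

lemma degX_pos:
  assumes "f \<in> S_set \<nu> n" "Q \<in> Psi \<nu> n"
  shows "0 < degX Q f"
proof (rule ccontr)
  assume "\<not> 0 < degX Q f"
  then have "degree f < n"
    using n_pos psi_degree[OF assms(2)] by (auto simp: degX_def div_eq_0_iff)
  then show False
    using assms trunc_small[OF assms(2)] by (auto simp: S_set_iff)
qed

text \<open>Beyond \<open>Q1\<close> the truncation of g - f exceeds every truncation of f, so f and
  g have equal truncations there. These lie strictly below both \<nu> f and \<nu> (g - f), hence
  below \<nu> g.\<close>

lemma S_set_perturb:
  assumes f: "f \<in> S_set \<nu> n" "\<And>Q. Q \<in> Psi \<nu> n \<Longrightarrow> trunc Q f \<le> C"
    and g: "Q1 \<in> Psi \<nu> n" "C < trunc Q1 (g - f)"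
  shows "g \<in> S_set \<nu> n"
  unfolding S_set_iff
proof
  fix Q assume Q: "Q \<in> Psi \<nu> n"
  obtain Q' where Q': "Q' \<in> Psi \<nu> n" "\<nu> Q < \<nu> Q'" "\<nu> Q1 < \<nu> Q'"
    using psi_above[of "{Q, Q1}"] Q g(1) by auto
  interpret t: poly_valuation "trunc Q'"
    by (rule trunc_poly_valuation)
  have lt: "trunc Q' f < trunc Q' (g - f)"
    using f(2)[OF Q'(1)] g(2) trunc_mono[OF g(1) Q'(1) less_imp_le[OF Q'(3)]]
    by (meson le_less_trans less_le_trans)
  have "trunc Q g \<le> trunc Q' g"
    using trunc_mono[OF Q Q'(1)] Q'(2) by auto
  also have "trunc Q' g = trunc Q' f"
    using t.val_add_eq[OF lt] by simp
  also have "trunc Q' f < min (\<nu> f) (\<nu> (g - f))"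
    using f(1) Q'(1) lt gauss_le_val[of "eps_of Q'" "g - f"] by (auto simp: S_set_iff)
  also have "\<dots> \<le> \<nu> g"
    using val_add[of f "g - f"] by simp
  finally show "trunc Q g < \<nu> g" .
qed

end

section \<open>The limit key polynomial F and its expansion in powers of Q\<close>

locale limit_setup = plateau +
  fixes F Q0 Q :: "'a poly" and B Bbar :: real
  assumes F: "limit_key_poly \<nu> n F"
    and Q0: "Q0 \<in> Psi \<nu> n" and Q: "Q \<in> Psi \<nu> n"
    and trunc_F_le: "\<And>Q'. Q' \<in> Psi \<nu> n \<Longrightarrow> trunc Q' F \<le> ereal Bbar"
    and trunc_F_sup: "\<And>x. x < Bbar \<Longrightarrow> \<exists>Q'\<in>Psi \<nu> n. ereal x < trunc Q' F"
    and val_le: "\<And>Q'. Q' \<in> Psi \<nu> n \<Longrightarrow> \<nu> Q' \<le> ereal B"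
    and val_sup: "\<And>x. x < B \<Longrightarrow> \<exists>Q'\<in>Psi \<nu> n. ereal x < \<nu> Q'"
    and gap: "ereal Bbar < trunc Q F + ereal (eps_of Q - eps_of Q0)"
begin

abbreviation "L \<equiv> qexp Q F"
abbreviation "d \<equiv> degX Q F"

lemma F_S: "F \<in> S_set \<nu> n"
  and F_monic: "lead_coeff F = 1"
  and F_minimal: "g \<in> S_set \<nu> n \<Longrightarrow> degree F \<le> degree g"
  using F by (auto simp: limit_key_poly_def)

lemma trunc_Q_F: "trunc Q F = ereal (real_of_ereal (trunc Q F))"
proof -
  have "F \<noteq> 0"
    using F_monic by auto
  then show ?thesis
    using gauss_finite[of F "eps_of Q"] by (cases "trunc Q F") auto
qed

lemma eps_Q0_le: "eps_of Q0 \<le> eps_of Q"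
  using trunc_F_le[OF Q] gap trunc_Q_F by (cases "trunc Q F") auto

lemma degree_Q_pos: "0 < degree Q"
  using n_pos psi_degree[OF Q] by simp

lemma degree_coeff_L: "degree (coeff L j) < n"
  using degree_qcoeff[OF degree_Q_pos, of F j] n_pos psi_degree[OF Q] by (auto simp: coeff_qexp)

lemma poly_L: "poly L Q = F"
  by (rule poly_qexp[OF degree_Q_pos])

lemma degree_L_le: "degree L \<le> d"
  by (rule degree_le) (simp add: coeff_qexp)

lemma trunc_F_coeff: "trunc Q F \<le> \<nu> (coeff L j) + ereal (j * val_of Q)"
  using gauss_poly_le[of Q "eps_of Q" "val_of Q" L j] eps_small[OF Q degree_coeff_L]
  by (simp add: psi_nonzero[OF Q] psi_eps[OF Q] trunc_self[OF Q] poly_L)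

lemma degree_term_less:
  assumes "degree Q' = n" "degree c + n * i < m"
  shows "degree (c * Q' ^ i) < (m :: nat)"
  using degree_mult_le[of c "Q' ^ i"] degree_power_le[of Q' i] assms by (simp add: mult.commute)

lemma term_less: "c < n \<Longrightarrow> i < k \<Longrightarrow> c + n * i < n * (k :: nat)"
  using mult_le_mono2[of "Suc i" k n] by simp

text \<open>The gain does not depend on \<open>Q1\<close> and \<open>Q2\<close>. Letting the modulus
  \<open>Q2\<close> lie beyond the truncation \<open>Q1\<close> allows errors modulo a moving key
  polynomial to be measured at a fixed one.\<close>

lemma trunc_mod_gap:
  assumes "Q1 \<in> Psi \<nu> n" "Q2 \<in> Psi \<nu> n" "\<nu> Q \<le> \<nu> Q1" "\<nu> Q1 \<le> \<nu> Q2"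
  shows "trunc Q0 f + ereal (eps_of Q - eps_of Q0) \<le> trunc Q1 (f - f mod Q2)"
proof -
  have e: "eps_of Q \<le> eps_of Q1" "eps_of Q1 \<le> eps_of Q2"
    using assms eps_of_less_iff Q by (meson not_le)+
  have "degree (f mod Q2) < n"
    using degree_mod_lt[of Q2 f] psi_degree[OF assms(2)] n_pos by simp
  then have "trunc Q0 f + ereal (eps_of Q1 - eps_of Q0) \<le> trunc Q1 (f - f mod Q2)"
    using eps_Q0_le e psi_eps[OF assms(2)] eps_small[OF Q0]
    by (intro gauss_mod_gap) (auto simp: psi_nonzero[OF assms(2)])
  moreover have "trunc Q0 f + ereal (eps_of Q - eps_of Q0) \<le> trunc Q0 f + ereal (eps_of Q1 - eps_of Q0)"
    using e by (intro add_left_mono) simp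
  ultimately show ?thesis
    by (rule order_trans[rotated])
qed

lemma d_pos: "0 < d"
  by (rule degX_pos[OF F_S Q])

lemma F_sum: "F = (\<Sum>i<d. coeff L i * Q ^ i) + coeff L d * Q ^ d"
  using poly_eq_sum_le[OF degree_L_le, of Q] poly_L by (simp add: lessThan_Suc_atMost[symmetric])

lemma degree_low: "degree Q' = n \<Longrightarrow> (\<And>i. degree (c i) < n) \<Longrightarrow> degree (\<Sum>i<d. c i * Q' ^ i) < n * d"
  using d_pos n_pos by (intro degree_sum_less degree_term_less term_less) auto

lemma degree_F_eq: "degree F = degree (coeff L d) + n * d"
  and coeff_L_d_lead: "lead_coeff (coeff L d) = 1"
proof -
  let ?P = "\<Sum>i<d. coeff L i * Q ^ i"
  have low: "degree ?P < n * d"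
    using psi_degree[OF Q] degree_coeff_L by (rule degree_low)
  have "n * d \<le> degree F"
    using psi_degree[OF Q] by (simp add: degX_def)
  then have a: "coeff L d \<noteq> 0"
    using low F_sum by auto
  have top: "degree (coeff L d * Q ^ d) = degree (coeff L d) + n * d"
    using a psi_nonzero[OF Q] psi_degree[OF Q]
    by (simp add: degree_mult_eq degree_power_eq mult.commute)
  then have less: "degree ?P < degree (coeff L d * Q ^ d)"
    using low by simp
  show "degree F = degree (coeff L d) + n * d"
    using F_sum degree_add_eq_right[OF less] top by simp
  have "lead_coeff F = lead_coeff (coeff L d * Q ^ d)"
    using F_sum lead_coeff_add_le[OF less] by simp
  then show "lead_coeff (coeff L d) = 1"
    using F_monic psi_lead[OF Q] by (simp add: lead_coeff_mult lead_coeff_power)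
qed

text \<open>If the leading coefficient \<open>a\<close> of \<open>L\<close> were not constant, then reducing the coefficients of
  \<open>(Q div a) * F\<close> modulo \<open>Q\<close> would produce an element of \<open>S_set\<close> of smaller degree.\<close>

lemma coeff_L_d: "coeff L d = 1"
proof -
  define a where "a = coeff L d"
  have "degree a = 0"
  proof (rule ccontr)
    assume a0: "degree a \<noteq> 0"
    \<comment> \<open>Modulo Q, the product s a is -t, of smaller degree than a: multiplying by s
      and reducing replaces the leading coefficient a of L by -t.\<close>
    define s t where "s = Q div a" and "t = Q mod a"
    have st: "s * a = Q - t"
      by (simp add: s_def t_def minus_mod_eq_div_mult)
    have a_n: "degree a < n"
      using degree_coeff_L by (simp add: a_def)
    have t_a: "degree t < degree a"
      using a0 by (simp add: t_def degree_mod_lt)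
    have s_nz: "s \<noteq> 0"
    proof
      assume "s = 0"
      then have "Q = t"
        using st by simp
      then show False
        using psi_degree[OF Q] t_a a_n by simp
    qed
    have "degree s + degree a = degree (Q - t)"
      using s_nz a0 by (subst st[symmetric], subst degree_mult_eq) auto
    also have "\<dots> \<le> n"
      using psi_degree[OF Q] t_a a_n by (intro degree_diff_le) auto
    finally have s_n: "degree s < n"
      using a0 by simp
    have s_val: "\<nu> s = ereal (val_of s)"
      using val_small[OF Q s_n s_nz] .
    interpret t: poly_valuation "trunc Q"
      by (rule trunc_poly_valuation)
    interpret t0: poly_valuation "trunc Q0"
      by (rule trunc_poly_valuation)
    define R where "R = map_poly (\<lambda>c. (s * c) mod Q) L"
    have coeff_R: "coeff R j = (s * coeff L j) mod Q" for j
      by (simp add: R_def coeff_map_poly)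
    define g where "g = poly R Q"
    \<comment> \<open>Multiplication by s, of degree below n, shifts all truncations and \<nu> by
      \<nu> s, so \<open>val_of s + Bbar\<close> bounds the truncations of \<open>s * F\<close>. The
      reduction errors lie above it by \<open>gap\<close>.\<close>
    have E: "ereal (val_of s + Bbar) < trunc Q (coeff (smult s L - R) j) + ereal (j * val_of Q)" for j
    proof -
      have "trunc Q0 (s * coeff L j) + ereal (eps_of Q - eps_of Q0)
          \<le> trunc Q (coeff (smult s L - R) j)"
        using trunc_mod_gap[OF Q Q, of "s * coeff L j"] by (simp add: coeff_R)
      moreover have "trunc Q0 (s * coeff L j) = ereal (val_of s) + \<nu> (coeff L j)"
        using s_n degree_coeff_L s_val by (simp add: t0.val_mult trunc_small[OF Q0])
      ultimately show ?thesis
        using gap trunc_F_coeff[of j] trunc_Q_F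
        by (cases "\<nu> (coeff L j)"; cases "trunc Q (coeff (smult s L - R) j)"; cases "trunc Q F") auto
    qed
    have "ereal (val_of s + Bbar) < trunc Q (poly (smult s L - R) Q)"
      using E by (intro t.val_poly_gt[of "val_of Q"]) (auto simp: trunc_self[OF Q])
    then have pert: "ereal (val_of s + Bbar) < trunc Q (g - s * F)"
      using t.val_minus[of "g - s * F"] by (simp add: g_def poly_L)
    have mult: "trunc Q' (s * f) = ereal (val_of s) + trunc Q' f" if "Q' \<in> Psi \<nu> n" for Q' f
      using that gauss_valuation s_val trunc_small[OF that s_n] by (simp add: rank_one_valuation_def)
    have "g \<in> S_set \<nu> n"
    proof (rule S_set_perturb[OF _ _ Q pert])
      show "s * F \<in> S_set \<nu> n"
        unfolding S_set_iff
      proof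
        fix Q' assume Q': "Q' \<in> Psi \<nu> n"
        have "trunc Q' F < \<nu> F"
          using F_S Q' by (auto simp: S_set_iff)
        then show "trunc Q' (s * F) < \<nu> (s * F)"
          unfolding mult[OF Q'] val_mult s_val by (cases "trunc Q' F"; cases "\<nu> F") auto
      qed
      show "trunc Q' (s * F) \<le> ereal (val_of s + Bbar)" if "Q' \<in> Psi \<nu> n" for Q'
        unfolding mult[OF that] using trunc_F_le[OF that] by (cases "trunc Q' F") auto
    qed
    then have "degree F \<le> degree g"
      by (rule F_minimal)
    moreover have "degree g < degree a + n * d"
    proof -
      have "coeff R d = (Q - t) mod Q"
        by (simp add: coeff_R flip: a_def st)
      also have "\<dots> = - t"
        using t_a a_n psi_degree[OF Q] by (simp add: mod_poly_less)
      finally have top: "coeff R d = - t" .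
      have "degree R \<le> d"
        by (rule degree_le) (simp add: coeff_R coeff_qexp)
      then have "g = (\<Sum>i<d. coeff R i * Q ^ i) + coeff R d * Q ^ d"
        unfolding g_def by (simp add: poly_eq_sum_le lessThan_Suc_atMost[symmetric])
      moreover have "degree (\<Sum>i<d. coeff R i * Q ^ i) < n * d"
        using psi_degree[OF Q] degree_mod_lt[OF degree_Q_pos]
        by (intro degree_low) (auto simp: coeff_R)
      moreover have "degree (coeff R d * Q ^ d) < degree a + n * d"
        using t_a by (intro degree_term_less psi_degree[OF Q]) (simp add: top)
      ultimately show ?thesis
        by (auto intro: degree_add_less)
    qed
    ultimately show False
      using degree_F_eq by (simp add: a_def)
  qed
  then show ?thesis
    using coeff_L_d_lead unfolding a_def by (auto elim!: degree_eq_zeroE simp: one_pCons)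
qed

lemma degree_F: "degree F = n * d"
  using degree_F_eq by (simp add: coeff_L_d)

section \<open>Re-expansion of F at a later key polynomial\<close>

definition M :: "'a poly \<Rightarrow> 'a poly poly" where
  "M Q' = pcompose L [:Q - Q', 1:]"

text \<open>The coefficients of \<open>M Q'\<close> may have degree n or more. The quotients by
  \<open>Q'\<close> are discarded rather than carried into the next coefficient, so
  \<open>poly (R Q') Q'\<close> is only an approximation of F, with errors controlled by
  \<open>coeff_error\<close>.\<close>

definition R :: "'a poly \<Rightarrow> 'a poly poly" where
  "R Q' = map_poly (\<lambda>c. c mod Q') (M Q')"

lemma coeff_M: "coeff (M Q') j = poly (hasse j L) (Q - Q')"
  by (simp add: M_def coeff_pcompose_linear)

lemma coeff_R: "coeff (R Q') j = coeff (M Q') j mod Q'"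
  by (simp add: R_def coeff_map_poly)

lemma poly_hasse_M: "poly (hasse i (M Q')) Q' = poly (hasse i L) Q"
  by (simp add: M_def hasse_pcompose_linear poly_pcompose)

lemma degree_coeff_R: "Q' \<in> Psi \<nu> n \<Longrightarrow> degree (coeff (R Q') j) < n"
  using degree_mod_lt[of Q'] n_pos psi_degree[of Q'] by (simp add: coeff_R)

text \<open>At \<open>Q0\<close> the coefficients of L and \<open>Q - Q'\<close> keep their
  \<nu>-values, having degree below n. Since \<nu> (Q - Q') is at least \<nu> Q and binomials have
  nonnegative value, the bound of \<open>trunc_F_coeff\<close> survives the shift.\<close>

lemma coeff_M_val:
  assumes "Q' \<in> Psi \<nu> n" "\<nu> Q \<le> \<nu> Q'"
  shows "trunc Q F \<le> trunc Q0 (coeff (M Q') m) + ereal (m * val_of Q)"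
proof -
  interpret t0: poly_valuation "trunc Q0"
    by (rule trunc_poly_valuation)
  have "trunc Q F - ereal (m * val_of Q) \<le> trunc Q0 (poly (hasse m L) (Q - Q'))"
  proof (rule t0.val_poly_ge)
    show "ereal (val_of Q) \<le> trunc Q0 (Q - Q')"
      using val_diff[of Q Q'] assms(2) psi_val[OF Q] psi_degree_diff[OF Q assms(1)]
      by (simp add: trunc_small[OF Q0] min_def)
    fix k
    have "\<nu> (coeff L (k + m)) \<le> trunc Q0 (coeff (hasse m L) k)"
      using t0.val_of_nat_mult[of "coeff L (k + m)" "(k + m) choose m"] trunc_small[OF Q0 degree_coeff_L]
      by (simp add: coeff_hasse)
    then show "trunc Q F - ereal (m * val_of Q)
        \<le> trunc Q0 (coeff (hasse m L) k) + ereal (k * val_of Q)"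
      using trunc_F_coeff[of "k + m"] trunc_Q_F
      by (cases "\<nu> (coeff L (k + m))"; cases "trunc Q0 (coeff (hasse m L) k)"; cases "trunc Q F")
        (auto simp: algebra_simps)
  qed
  then show ?thesis
    unfolding coeff_M using trunc_Q_F
    by (cases "trunc Q F"; cases "trunc Q0 (poly (hasse m L) (Q - Q'))") auto
qed

lemma coeff_error:
  assumes "Q1 \<in> Psi \<nu> n" "Q' \<in> Psi \<nu> n" "\<nu> Q \<le> \<nu> Q1" "\<nu> Q1 \<le> \<nu> Q'"
  shows "ereal Bbar < trunc Q1 (coeff (M Q' - R Q') m) + ereal (m * val_of Q)"
proof -
  have "trunc Q F \<le> trunc Q0 (coeff (M Q') m) + ereal (m * val_of Q)"
    using assms by (intro coeff_M_val) auto
  moreover have "trunc Q0 (coeff (M Q') m) + ereal (eps_of Q - eps_of Q0)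
      \<le> trunc Q1 (coeff (M Q' - R Q') m)"
    using trunc_mod_gap[OF assms] by (simp add: coeff_R)
  ultimately show ?thesis
    using gap trunc_Q_F
    by (cases "trunc Q F"; cases "trunc Q0 (coeff (M Q') m)"; cases "trunc Q1 (coeff (M Q' - R Q') m)")
      auto
qed

text \<open>The i-th derivative removes i factors \<open>Q'\<close>, each of truncated value
  \<open>val_of Q1\<close>; the binomial factors do not lower the value.\<close>

lemma hasse_error:
  assumes "Q1 \<in> Psi \<nu> n" "Q' \<in> Psi \<nu> n" "\<nu> Q \<le> \<nu> Q1" "\<nu> Q1 \<le> \<nu> Q'"
  shows "ereal (Bbar - i * val_of Q1) < trunc Q1 (poly (hasse i (M Q' - R Q')) Q')"
proof -
  interpret t: poly_valuation "trunc Q1"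
    by (rule trunc_poly_valuation)
  have le: "val_of Q \<le> val_of Q1"
    using assms(3) psi_val[OF Q] psi_val[OF assms(1)] by simp
  show ?thesis
  proof (rule t.val_poly_gt)
    show "ereal (val_of Q1) \<le> trunc Q1 Q'"
      using trunc_later[OF assms(1,2,4)] by simp
    fix k
    let ?E = "coeff (M Q' - R Q') (k + i)"
    have "trunc Q1 ?E \<le> trunc Q1 (coeff (hasse i (M Q' - R Q')) k)"
      unfolding coeff_hasse by (rule t.val_of_nat_mult)
    moreover have "ereal Bbar < trunc Q1 ?E + ereal ((k + i) * val_of Q)"
      using coeff_error[OF assms, of "k + i"] by simp
    moreover have "(k + i) * val_of Q \<le> (k + i) * val_of Q1"
      using le by (simp add: mult_left_mono)
    ultimately show "ereal (Bbar - i * val_of Q1)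
        < trunc Q1 (coeff (hasse i (M Q' - R Q')) k) + ereal (k * val_of Q1)"
      by (cases "trunc Q1 ?E"; cases "trunc Q1 (coeff (hasse i (M Q' - R Q')) k)")
        (auto simp: algebra_simps)
  qed simp
qed

section \<open>Stability of the derivatives and bounds for the coefficients\<close>

lemma derivative_stable:
  assumes "1 \<le> i"
  shows "\<exists>Q1\<in>Psi \<nu> n. trunc Q1 (poly (hasse i L) Q) = \<nu> (poly (hasse i L) Q)"
proof -
  have "degree (hasse i L) \<le> d - 1"
    using assms by (intro degree_le) (auto simp: coeff_hasse coeff_qexp)
  then have "poly (hasse i L) Q = (\<Sum>k\<le>d - 1. coeff (hasse i L) k * Q ^ k)"
    by (rule poly_eq_sum_le)
  also have "\<dots> = (\<Sum>k<d. coeff (hasse i L) k * Q ^ k)"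
    using d_pos by (intro sum.cong) auto
  also have "degree \<dots> < n * d"
  proof (rule degree_low[OF psi_degree[OF Q]])
    fix k
    show "degree (coeff (hasse i L) k) < n"
      using degree_mult_le[of "of_nat ((k + i) choose i)" "coeff L (k + i)"] degree_coeff_L[of "k + i"]
      by (simp add: coeff_hasse)
  qed
  finally have "poly (hasse i L) Q \<notin> S_set \<nu> n"
    using F_minimal degree_F by (metis not_le)
  then show ?thesis
    unfolding S_set_iff by (meson antisym gauss_le_val not_le)
qed

text \<open>Kaplansky's argument: once \<open>\<partial>\<^sub>i L (Q)\<close> is stable, the coefficients of its \<open>Q'\<close>-expansion,
  which are binomial multiples of those of \<open>F\<close>, are bounded below uniformly in \<open>Q'\<close>.\<close>

lemma coeff_R_large:
  assumes i: "1 \<le> i" "i < j" and unit: "\<nu> (of_nat (j choose i)) = 0"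
  shows "\<exists>Q1\<in>Psi \<nu> n. \<forall>Q'\<in>Psi \<nu> n. \<nu> Q1 < \<nu> Q' \<longrightarrow>
           ereal Bbar < \<nu> (coeff (R Q') j) + ereal (j * val_of Q')"
proof -
  define G where "G = poly (hasse i L) Q"
  obtain Qa where Qa: "Qa \<in> Psi \<nu> n" "trunc Qa G = \<nu> G"
    using derivative_stable[OF i(1)] by (auto simp: G_def)
  \<comment> \<open>\<open>Qs\<close> is the fixed reference: from it on, every truncation of G is
    \<nu> G.\<close>
  obtain Qs where Qs: "Qs \<in> Psi \<nu> n" "\<nu> Qa < \<nu> Qs" "\<nu> Q < \<nu> Qs"
    using psi_above[of "{Qa, Q}"] Qa(1) Q by auto
  have stable: "trunc Q' G = \<nu> G" if "Q' \<in> Psi \<nu> n" "\<nu> Qs \<le> \<nu> Q'" for Q'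
  proof (rule antisym[OF gauss_le_val])
    have "trunc Qa G \<le> trunc Q' G"
      using Qa(1) that Qs by (intro trunc_mono) auto
    then show "\<nu> G \<le> trunc Q' G"
      using Qa(2) by simp
  qed
  define H where "H Q' = poly (hasse i (R Q')) Q'" for Q'
  define E where "E Q' = poly (hasse i (M Q' - R Q')) Q'" for Q'
  have GHE: "G = H Q' + E Q'" for Q'
    by (simp add: G_def H_def E_def hasse_diff flip: poly_hasse_M)
  have val_le': "val_of Q' \<le> B" if "Q' \<in> Psi \<nu> n" for Q'
    using val_le[OF that] psi_val[OF that] by simp
  have small: "degree (coeff (hasse i (R Q')) k) < n" if "Q' \<in> Psi \<nu> n" for Q' k
    using degree_mult_le[of "of_nat ((k + i) choose i)" "coeff (R Q') (k + i)"]
      degree_coeff_R[OF that, of "k + i"]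
    by (simp add: coeff_hasse)
  \<comment> \<open>The truncation at the fixed \<open>Qs\<close> bounds the coefficients with
    weight \<open>val_of Qs\<close>, smaller than \<open>val_of Q'\<close>; this difference of
    weights is what both later estimates exploit.\<close>
  have coeff_H: "trunc Qs (H Q') \<le> \<nu> (coeff (hasse i (R Q')) k) + ereal (k * val_of Qs)"
    if "Q' \<in> Psi \<nu> n" "\<nu> Qs < \<nu> Q'" for Q' k
    unfolding H_def
  proof (rule gauss_poly_le)
    show "ereal (eps_of Qs) \<le> eps \<nu> Q'"
      using that Qs(1) eps_of_less_iff[OF Qs(1) that(1)] by (simp add: psi_eps)
    show "trunc Qs Q' = ereal (val_of Qs)"
      using that Qs(1) by (simp add: trunc_later)
    show "coeff (hasse i (R Q')) j = 0 \<or> eps \<nu> (coeff (hasse i (R Q')) j) < ereal (eps_of Qs)" for j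
      using eps_small[OF Qs(1) small[OF that(1)]] by simp
  qed (rule psi_nonzero[OF that(1)])
  have E_Qs: "ereal (Bbar - i * B) < trunc Qs (E Q')" if "Q' \<in> Psi \<nu> n" "\<nu> Qs < \<nu> Q'" for Q'
  proof -
    have "ereal (Bbar - i * val_of Qs) < trunc Qs (E Q')"
      unfolding E_def using that Qs by (intro hasse_error) auto
    then show ?thesis
      using val_le'[OF Qs(1)] by (auto intro: le_less_trans[rotated] simp: mult_left_mono)
  qed
  have H_Qs: "min (\<nu> G) (ereal (Bbar - i * B)) \<le> trunc Qs (H Q')"
    if "Q' \<in> Psi \<nu> n" "\<nu> Qs < \<nu> Q'" for Q'
  proof -
    interpret t: poly_valuation "trunc Qs"
      by (rule trunc_poly_valuation)
    show ?thesis
      using t.val_diff[of G "E Q'"] E_Qs[OF that] stable[OF Qs(1)] GHE[of Q']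
      by (auto simp: min_def split: if_splits)
  qed
  \<comment> \<open>If \<nu> G = \<beta> were smaller, the i-th coefficient of every later
    \<open>R Q'\<close> would have value at most \<beta>. That would cap the truncations of F at
    \<beta> + i B < Bbar, against the choice of \<open>Bbar\<close> as a supremum.\<close>
  have lower: "ereal (Bbar - i * B) \<le> \<nu> G"
  proof (rule ccontr)
    assume "\<not> ereal (Bbar - i * B) \<le> \<nu> G"
    then obtain \<beta> where \<beta>: "\<nu> G = ereal \<beta>" "\<beta> < Bbar - i * B"
      using val_ninf[of G] by (cases "\<nu> G") auto
    have bound: "trunc Q' F \<le> ereal (\<beta> + i * B)" if Q': "Q' \<in> Psi \<nu> n" "\<nu> Qs < \<nu> Q'" for Q'
    proof -
      interpret t: poly_valuation "trunc Q'"
        by (rule trunc_poly_valuation)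
      have err: "ereal (Bbar - k * val_of Q') < trunc Q' (poly (hasse k (M Q' - R Q')) Q')" for k
        using Q' Qs by (intro hasse_error) auto
      have "Bbar - i * B \<le> Bbar - i * val_of Q'"
        using val_le'[OF Q'(1)] by (simp add: mult_left_mono)
      then have "ereal \<beta> < ereal (Bbar - i * val_of Q')"
        using \<beta>(2) by simp
      also note err[of i]
      finally have E_gt: "ereal \<beta> < trunc Q' (E Q')"
        by (simp add: E_def)
      \<comment> \<open>The coefficients of positive index k in \<open>H Q'\<close> contribute at
        least \<beta> with the weight of \<open>Qs\<close>, hence strictly more with that of
        \<open>Q'\<close>. As \<open>E Q'\<close> also lies above \<beta>, only the constant
        coefficient, which is \<open>coeff (R Q') i\<close>, can account for the value \<beta> of
        G.\<close>
      have "\<nu> (coeff (R Q') i) \<le> ereal \<beta>"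
      proof (rule ccontr)
        assume r: "\<not> \<nu> (coeff (R Q') i) \<le> ereal \<beta>"
        have "ereal \<beta> < trunc Q' (H Q')"
          unfolding H_def
        proof (rule t.val_poly_gt)
          show "ereal (val_of Q') \<le> trunc Q' Q'"
            by (simp add: trunc_self[OF Q'(1)])
          fix k
          let ?c = "coeff (hasse i (R Q')) k"
          show "ereal \<beta> < trunc Q' ?c + ereal (k * val_of Q')"
          proof (cases "k = 0")
            case True
            then show ?thesis
              using r by (simp add: trunc_small[OF Q'(1) small[OF Q'(1)]]) (simp add: coeff_hasse)
          next
            case False
            have "ereal \<beta> \<le> \<nu> ?c + ereal (k * val_of Qs)"
              using H_Qs[OF Q'] coeff_H[OF Q', of k] \<beta> by (auto simp: min_def)
            moreover have "k * val_of Qs < k * val_of Q'"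
              using False Q'(2) psi_val[OF Q'(1)] psi_val[OF Qs(1)] by simp
            ultimately show ?thesis
              unfolding trunc_small[OF Q'(1) small[OF Q'(1)]] by (cases "\<nu> ?c") auto
          qed
        qed simp
        then have "ereal \<beta> < trunc Q' G"
          using t.val_add[of "H Q'" "E Q'"] E_gt GHE[of Q'] by (auto simp: min_def split: if_splits)
        then show False
          using stable[OF Q'(1)] Q'(2) \<beta> by simp
      qed
      moreover have "trunc Q' (poly (R Q') Q') \<le> \<nu> (coeff (R Q') i) + ereal (i * val_of Q')"
        using eps_small[OF Q'(1) degree_coeff_R[OF Q'(1)]]
        by (intro gauss_poly_le) (auto simp: psi_nonzero[OF Q'(1)] psi_eps[OF Q'(1)] trunc_self[OF Q'(1)])
      moreover have "i * val_of Q' \<le> i * B"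
        using val_le'[OF Q'(1)] by (simp add: mult_left_mono)
      ultimately have R_le: "trunc Q' (poly (R Q') Q') \<le> ereal (\<beta> + i * B)"
        by (cases "\<nu> (coeff (R Q') i)"; cases "trunc Q' (poly (R Q') Q')") auto
      have "F = poly (M Q') Q'"
        using poly_hasse_M[of 0 Q'] by (simp add: poly_L)
      then have "poly (R Q') Q' = F - poly (hasse 0 (M Q' - R Q')) Q'"
        by simp
      then have "min (trunc Q' F) (trunc Q' (poly (hasse 0 (M Q' - R Q')) Q')) \<le> ereal (\<beta> + i * B)"
        using t.val_diff[of F "poly (hasse 0 (M Q' - R Q')) Q'"] R_le by simp
      moreover have "ereal (\<beta> + i * B) < trunc Q' (poly (hasse 0 (M Q' - R Q')) Q')"
        using err[of 0] \<beta>(2) by (auto intro: less_trans[rotated])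
      ultimately show ?thesis
        by (auto simp: min_def split: if_splits)
    qed
    obtain Q2 where Q2: "Q2 \<in> Psi \<nu> n" "ereal (\<beta> + i * B) < trunc Q2 F"
      using trunc_F_sup[of "\<beta> + i * B"] \<beta>(2) by auto
    obtain Q' where Q': "Q' \<in> Psi \<nu> n" "\<nu> Q2 < \<nu> Q'" "\<nu> Qs < \<nu> Q'"
      using psi_above[of "{Q2, Qs}"] Q2(1) Qs(1) by auto
    then show False
      using bound[OF Q'(1,3)] trunc_mono[OF Q2(1) Q'(1) less_imp_le[OF Q'(2)], of F] Q2(2)
      by (meson not_le order_trans)
  qed
  \<comment> \<open>The aim is the lower bound Bbar - i (B - \<open>val_of Q'\<close>) + (j - i)
    (\<open>val_of Q'\<close> - \<open>val_of Qs\<close>). Since j - i \<ge> 1, the last summand is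
    at least \<delta> beyond \<open>Qt\<close>, while i (B - \<open>val_of Q'\<close>) is below
    \<delta> beyond \<open>Qu\<close>.\<close>
  obtain Qt where Qt: "Qt \<in> Psi \<nu> n" "\<nu> Qs < \<nu> Qt"
    using psi_above[of "{Qs}"] Qs(1) by auto
  define \<delta> where "\<delta> = val_of Qt - val_of Qs"
  have \<delta>: "\<delta> > 0"
    using Qt psi_val[OF Qt(1)] psi_val[OF Qs(1)] by (simp add: \<delta>_def)
  obtain Qu where Qu: "Qu \<in> Psi \<nu> n" "ereal (B - \<delta> / i) < \<nu> Qu"
    using val_sup[of "B - \<delta> / i"] \<delta> i(1) by auto
  obtain Qv where Qv: "Qv \<in> Psi \<nu> n" "\<nu> Qu < \<nu> Qv" "\<nu> Qt < \<nu> Qv"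
    using psi_above[of "{Qu, Qt}"] Qu(1) Qt(1) by auto
  have "ereal Bbar < \<nu> (coeff (R Q') j) + ereal (j * val_of Q')"
    if Q': "Q' \<in> Psi \<nu> n" "\<nu> Qv < \<nu> Q'" for Q'
  proof -
    have Qs': "\<nu> Qs < \<nu> Q'"
      using Qt Qv Q' by (meson less_trans)
    have "\<nu> (coeff (hasse i (R Q')) (j - i)) = \<nu> (coeff (R Q') j)"
      using unit i by (simp add: coeff_hasse val_mult)
    moreover have "real (j - i) = real j - real i"
      using i(2) by (simp add: of_nat_diff)
    moreover have "ereal (Bbar - i * B) \<le> trunc Qs (H Q')"
      using H_Qs[OF Q'(1) Qs'] lower by (simp only: min_absorb2)
    ultimately have *: "ereal (Bbar - i * B) \<le> \<nu> (coeff (R Q') j) + ereal ((real j - real i) * val_of Qs)"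
      using coeff_H[OF Q'(1) Qs', of "j - i"] by (metis order_trans)
    have "val_of Qt < val_of Q'" "B - \<delta> / i < val_of Q'"
      using Q' Qv Qu Qt psi_val by (metis ereal_less(4) less_trans less_ereal.simps(1))+
    then have 1: "i * (B - val_of Q') < \<delta>" and 2: "\<delta> \<le> val_of Q' - val_of Qs"
      using i(1) by (auto simp: \<delta>_def field_simps)
    have "1 * (val_of Q' - val_of Qs) \<le> (real j - real i) * (val_of Q' - val_of Qs)"
      using 2 \<delta> i(2) by (intro mult_right_mono) auto
    then have "Bbar < Bbar - i * B - (real j - real i) * val_of Qs + j * val_of Q'"
      using 1 2 by (simp add: algebra_simps)
    then show ?thesis
      using * by (cases "\<nu> (coeff (R Q') j)") auto
  qed
  with Qv(1) show ?thesis
    by blast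
qed

text \<open>The first sum keeps the unreduced Taylor coefficients, the second has coefficients of
  degree below n. Both differ from F by terms whose truncation at \<open>Q'\<close> exceeds
  \<open>Bbar\<close>, so \<open>S_set_perturb\<close> applies to each; only the degree bounds
  differ.\<close>

lemma truncated_sums:
  assumes Q': "Q' \<in> Psi \<nu> n" "\<nu> Q < \<nu> Q'"
    and J: "J \<subseteq> {..d}"
    and large: "\<And>j. j \<in> {..d} - J \<Longrightarrow> ereal Bbar < \<nu> (coeff (R Q') j) + ereal (j * val_of Q')"
  shows "limit_key_poly \<nu> n (\<Sum>j\<in>J. coeff (M Q') j * Q' ^ j)"
    and "limit_key_poly \<nu> n (\<Sum>j\<in>J. coeff (R Q') j * Q' ^ j)"
proof -
  interpret t: poly_valuation "trunc Q'"
    by (rule trunc_poly_valuation)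
  define A where "A = (\<Sum>j\<in>J. coeff (M Q') j * Q' ^ j)"
  define A' where "A' = (\<Sum>j\<in>J. coeff (R Q') j * Q' ^ j)"
  have J_fin: "finite J"
    using J finite_subset by blast
  have mult: "trunc Q' (c * Q' ^ j) \<ge> trunc Q' c + ereal (j * val_of Q')" for c j
    by (rule t.val_mult_power_ge) (simp add: trunc_self[OF Q'(1)])
  have R_term: "ereal Bbar < trunc Q' (coeff (R Q') j * Q' ^ j)" if "j \<in> {..d} - J" for j
    using large[OF that] mult[of "coeff (R Q') j" j] trunc_small[OF Q'(1) degree_coeff_R[OF Q'(1)]]
    by (simp add: less_le_trans)
  have E_term: "ereal Bbar < trunc Q' (coeff (M Q' - R Q') j * Q' ^ j)" for j
  proof -
    have "j * val_of Q \<le> j * val_of Q'"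
      using Q' psi_val[OF Q] psi_val[OF Q'(1)] by (simp add: mult_left_mono)
    then have "ereal Bbar < trunc Q' (coeff (M Q' - R Q') j) + ereal (j * val_of Q')"
      using coeff_error[OF Q'(1,1) less_imp_le[OF Q'(2)] order_refl, of j] by (cases "trunc Q' (coeff (M Q' - R Q') j)") auto
    then show ?thesis
      using mult by (rule less_le_trans)
  qed
  have M_term: "ereal Bbar < trunc Q' (coeff (M Q') j * Q' ^ j)" if "j \<in> {..d} - J" for j
  proof -
    have "ereal Bbar < min (trunc Q' (coeff (R Q') j * Q' ^ j))
        (trunc Q' (coeff (M Q' - R Q') j * Q' ^ j))"
      using R_term[OF that] E_term[of j] by simp
    also have "\<dots> \<le> trunc Q' (coeff (R Q') j * Q' ^ j + coeff (M Q' - R Q') j * Q' ^ j)"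
      by (rule t.val_add)
    also have "coeff (R Q') j * Q' ^ j + coeff (M Q' - R Q') j * Q' ^ j = coeff (M Q') j * Q' ^ j"
      by (simp flip: distrib_right)
    finally show ?thesis .
  qed
  have "degree (M Q') \<le> d"
    using degree_L_le by (simp add: M_def degree_pcompose)
  then have "poly (M Q') Q' = (\<Sum>j\<le>d. coeff (M Q') j * Q' ^ j)"
    by (rule poly_eq_sum_le)
  then have F_eq: "F = (\<Sum>j\<in>{..d} - J. coeff (M Q') j * Q' ^ j) + A"
    using poly_hasse_M[of 0 Q'] J by (simp add: poly_L A_def sum.subset_diff)
  have A_diff: "ereal Bbar < trunc Q' (F - A)"
  proof -
    have "F - A = (\<Sum>j\<in>{..d} - J. coeff (M Q') j * Q' ^ j)"
      by (subst diff_eq_eq) (rule F_eq)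
    then show ?thesis
      using M_term by (simp only:) (intro t.val_sum_gt, auto)
  qed
  have "A - A' = (\<Sum>j\<in>J. coeff (M Q' - R Q') j * Q' ^ j)"
    by (simp add: A_def A'_def sum_subtractf algebra_simps)
  then have "ereal Bbar < trunc Q' (A - A')"
    using E_term by (simp add: t.val_sum_gt)
  then have A'_diff: "ereal Bbar < trunc Q' (F - A')"
    using t.val_add[of "F - A" "A - A'"] A_diff by (auto simp: min_def split: if_splits)
  have S: "g \<in> S_set \<nu> n" if "ereal Bbar < trunc Q' (F - g)" for g
    using that t.val_minus[of "F - g"] by (intro S_set_perturb[OF F_S trunc_F_le Q'(1)]) auto
  have top_M: "coeff (M Q') d = 1"
  proof -
    have "hasse d L = [:1:]"
    proof (rule poly_eqI)
      show "coeff (hasse d L) k = coeff [:1:] k" for k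
        using coeff_L_d by (cases k) (auto simp: coeff_hasse coeff_qexp)
    qed
    then show ?thesis
      by (simp add: coeff_M)
  qed
  have top_R: "coeff (R Q') d = 1"
    using n_pos psi_degree[OF Q'(1)] by (simp add: coeff_R top_M mod_poly_less)
  have low_R: "degree (coeff (R Q') j * Q' ^ j) < n * d" if "j < d" for j
    using that degree_coeff_R[OF Q'(1)] by (intro degree_term_less term_less psi_degree[OF Q'(1)])
  \<comment> \<open>Coefficients of \<open>M Q'\<close> may have degree n or more, so this needs a
    count. Since \<open>coeff L d\<close> is 1, the summand with k = d - j contributes only the
    degree of the power of \<open>Q - Q'\<close>; all summands stay within (d - j)(n - 1), and
    adding n j stays below n d.\<close>
  have low_M: "degree (coeff (M Q') j * Q' ^ j) < n * d" if j: "j < d" for j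
  proof -
    have "degree (coeff (hasse j L) k * (Q - Q') ^ k) \<le> (d - j) * (n - 1)" for k
    proof -
      have "degree (coeff (hasse j L) k * (Q - Q') ^ k)
          \<le> degree (coeff (hasse j L) k) + degree (Q - Q') * k"
        using degree_mult_le[of "coeff (hasse j L) k" "(Q - Q') ^ k"] degree_power_le[of "Q - Q'" k]
        by linarith
      also have "\<dots> \<le> degree (coeff L (k + j)) + (n - 1) * k"
      proof (rule add_mono)
        show "degree (coeff (hasse j L) k) \<le> degree (coeff L (k + j))"
          using degree_mult_le[of "of_nat ((k + j) choose j)" "coeff L (k + j)"]
          by (simp add: coeff_hasse)
        show "degree (Q - Q') * k \<le> (n - 1) * k"
          using psi_degree_diff[OF Q Q'(1)] by (intro mult_right_mono) auto
      qed
      finally have le: "degree (coeff (hasse j L) k * (Q - Q') ^ k)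
          \<le> degree (coeff L (k + j)) + (n - 1) * k" .
      consider "k + j < d" | "k + j = d" | "k + j > d"
        by linarith
      then show ?thesis
      proof cases
        case 1
        have "degree (coeff L (k + j)) + (n - 1) * k \<le> (n - 1) * Suc k"
          using degree_coeff_L[of "k + j"] by simp
        also have "\<dots> \<le> (n - 1) * (d - j)"
          using 1 by (intro mult_le_mono2) auto
        finally show ?thesis
          using le by (simp add: mult.commute)
      next
        case 2
        then have "k = d - j"
          by simp
        then show ?thesis
          using le 2 coeff_L_d by (simp add: mult.commute)
      next
        case 3
        then show ?thesis
          by (simp add: coeff_hasse coeff_qexp)
      qed
    qed
    then have "degree (coeff (M Q') j) \<le> (d - j) * (n - 1)"
      unfolding coeff_M poly_altdef by (intro degree_sum_le) auto
    moreover have "(d - j) * (n - 1) + n * j < n * d"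
    proof -
      have "(d - j) * (n - 1) < (d - j) * n"
        using j n_pos by simp
      also have "(d - j) * n + n * j = n * d"
        using j by (simp add: algebra_simps diff_mult_distrib)
      finally show ?thesis
        by simp
    qed
    ultimately show ?thesis
      by (intro degree_term_less psi_degree[OF Q'(1)]) simp
  qed
  have d_J: "d \<in> J"
  proof (rule ccontr)
    assume "d \<notin> J"
    then have "j < d" if "j \<in> J" for j
      using J that by (metis atMost_iff order_le_less subsetD)
    then have "degree A' < n * d"
      unfolding A'_def using low_R n_pos d_pos by (intro degree_sum_less) auto
    then show False
      using F_minimal[OF S[OF A'_diff]] degree_F by simp
  qed
  have J': "j < d" if "j \<in> J - {d}" for j
    using J that by force
  have monic: "lead_coeff g = 1 \<and> degree g = n * d"
    if g: "g = (\<Sum>j\<in>J. c j * Q' ^ j)" and c: "c d = 1"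
      "\<And>j. j < d \<Longrightarrow> degree (c j * Q' ^ j) < n * d" for g c
  proof -
    have g': "g = (\<Sum>j\<in>J - {d}. c j * Q' ^ j) + Q' ^ d"
      unfolding g using sum.remove[OF J_fin d_J, of "\<lambda>j. c j * Q' ^ j"] c(1) by simp
    have top: "degree (Q' ^ d) = n * d"
      using psi_nonzero[OF Q'(1)] psi_degree[OF Q'(1)] by (simp add: degree_power_eq mult.commute)
    have low: "degree (\<Sum>j\<in>J - {d}. c j * Q' ^ j) < degree (Q' ^ d)"
      unfolding top using c(2) J' n_pos d_pos by (intro degree_sum_less) auto
    have "lead_coeff g = lead_coeff Q' ^ d"
      unfolding g' by (simp only: lead_coeff_add_le[OF low] lead_coeff_power)
    moreover have "degree g = n * d"
      unfolding g' by (simp only: degree_add_eq_right[OF low] top)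
    ultimately show ?thesis
      using psi_lead[OF Q'(1)] by simp
  qed
  have "lead_coeff A = 1 \<and> degree A = n * d"
    by (rule monic[OF A_def top_M low_M])
  then show "limit_key_poly \<nu> n A"
    unfolding limit_key_poly_def using S[OF A_diff] F_minimal degree_F by metis
  have "lead_coeff A' = 1 \<and> degree A' = n * d"
    by (rule monic[OF A'_def top_R low_R])
  then show "limit_key_poly \<nu> n A'"
    unfolding limit_key_poly_def using S[OF A'_diff] F_minimal degree_F by metis
qed

end

text \<open>The type \<open>'i\<close> plays the role of the limit ordinal: a wellorder without
  greatest element. In the first sum the index set is cut at d, beyond which the derivatives of L
  vanish; in the second the bound N makes the sum finite.\<close>

theorem theorem1p1:
  fixes \<nu> :: "'a::field poly \<Rightarrow> ereal"
    and n :: nat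
    and F Q0 Q :: "'a poly"
    and Qf :: "'i::wellorder \<Rightarrow> 'a poly"
  assumes val: "rank_one_valuation \<nu>"
    and n1: "n \<ge> 1"
    and Psi_ne: "Psi \<nu> n \<noteq> {}"
    and bnd: "\<exists>a. \<forall>Q'\<in>Psi \<nu> n. \<nu> a > \<nu> Q'"
    and nomax: "\<not> (\<exists>Q1\<in>Psi \<nu> n. \<forall>Q'\<in>Psi \<nu> n. \<nu> Q' \<le> \<nu> Q1)"
    and F: "limit_key_poly \<nu> n F"
    and Bbar_real: "(SUP Q'\<in>Psi \<nu> n. trunc_val \<nu> Q' F) \<in> range ereal"
    and Q0: "Q0 \<in> Psi \<nu> n"
    and Q: "Q \<in> Psi \<nu> n"
    and c1: "eps \<nu> Q - eps \<nu> Q0 >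
               ereal (real (degX Q F)) * ((SUP Q'\<in>Psi \<nu> n. \<nu> Q') - \<nu> Q)"
    and c2: "eps \<nu> Q - eps \<nu> Q0 > (SUP Q'\<in>Psi \<nu> n. trunc_val \<nu> Q' F) - trunc_val \<nu> Q F"
    and limit: "\<forall>\<rho>::'i. \<exists>\<sigma>. \<rho> < \<sigma>"
    and Qf_Psi: "\<forall>\<rho>. Qf \<rho> \<in> Psi \<nu> n \<and> eps \<nu> Q < eps \<nu> (Qf \<rho>)"
    and Qf_mono: "\<forall>\<rho> \<sigma>. \<rho> < \<sigma> \<longrightarrow> \<nu> (Qf \<rho>) < \<nu> (Qf \<sigma>)"
    and Qf_cofinal: "\<forall>Q'\<in>Psi \<nu> n. \<exists>\<rho>. \<nu> Q' < \<nu> (Qf \<rho>)"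
  shows "let L = qexp Q F; d = degX Q F; p = residue_char \<nu>;
             I = (if p > 0 then {p ^ t | t. True} else {1::nat});
             h = (\<lambda>\<rho>. Q - Qf \<rho>)
         in \<exists>\<sigma>. \<forall>\<theta>. \<sigma> < \<theta> \<longrightarrow>
              limit_key_poly \<nu> n
                 (poly L (h \<theta>) + (\<Sum>i\<in>{i\<in>I. i \<le> d}. poly (hasse i L) (h \<theta>) * Qf \<theta> ^ i))
            \<and> (\<exists>(a :: nat \<Rightarrow> 'a poly) N. (\<forall>i. degree (a i) < n) \<and>
                 limit_key_poly \<nu> n (\<Sum>i\<in>{i\<in>I \<union> {0}. i \<le> N}. a i * Qf \<theta> ^ i))"
proof -
  interpret plateau \<nu> n
    using val n1 bnd nomax by unfold_locales
  have F_S: "F \<in> S_set \<nu> n"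
    using F by (simp add: limit_key_poly_def)
  have trunc_SUP: "(SUP Q'\<in>Psi \<nu> n. trunc_val \<nu> Q' F) = (SUP Q'\<in>Psi \<nu> n. trunc Q' F)"
    by (rule SUP_cong) (simp_all add: trunc_val_eq)
  obtain Bbar where Bbar: "(SUP Q'\<in>Psi \<nu> n. trunc Q' F) = ereal Bbar"
    using Bbar_real unfolding trunc_SUP by blast
  define SB where "SB = (SUP Q'\<in>Psi \<nu> n. \<nu> Q')"
  have "\<nu> Q \<le> SB"
    unfolding SB_def using Q by (rule SUP_upper)
  then have "SB \<noteq> -\<infinity>"
    using psi_val[OF Q] by auto
  \<comment> \<open>Since d > 0, an infinite supremum would make the right side of \<open>c1\<close>
    infinite, while the left side is real.\<close>
  moreover have "SB \<noteq> \<infinity>"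
    using c1 degX_pos[OF F_S Q] unfolding SB_def[symmetric] psi_eps[OF Q] psi_eps[OF Q0] psi_val[OF Q]
    by auto
  ultimately obtain B where B: "SB = ereal B"
    by (cases SB) auto
  interpret limit_setup \<nu> n F Q0 Q B Bbar
  proof unfold_locales
    show "trunc Q' F \<le> ereal Bbar" if "Q' \<in> Psi \<nu> n" for Q'
      unfolding Bbar[symmetric] using that by (rule SUP_upper)
    show "\<exists>Q'\<in>Psi \<nu> n. ereal x < trunc Q' F" if "x < Bbar" for x
      using that unfolding less_SUP_iff[symmetric] Bbar by simp
    show "\<nu> Q' \<le> ereal B" if "Q' \<in> Psi \<nu> n" for Q'
      unfolding B[symmetric] SB_def using that by (rule SUP_upper)
    show "\<exists>Q'\<in>Psi \<nu> n. ereal x < \<nu> Q'" if "x < B" for x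
      using that unfolding less_SUP_iff[symmetric] SB_def[symmetric] B by simp
    show "ereal Bbar < trunc Q F + ereal (eps_of Q - eps_of Q0)"
      using c2[unfolded trunc_SUP Bbar] psi_eps[OF Q] psi_eps[OF Q0]
      by (cases "trunc Q F") (auto simp: trunc_val_eq[OF Q])
  qed (use F Q0 Q in auto)
  define I where "I = (if residue_char \<nu> > 0 then {residue_char \<nu> ^ t | t. True} else {1})"
  define P where "P j Q1 \<longleftrightarrow> (\<forall>Q'\<in>Psi \<nu> n. \<nu> Q1 < \<nu> Q' \<longrightarrow>
      ereal Bbar < \<nu> (coeff (R Q') j) + ereal (j * val_of Q'))" for j Q1
  have "\<forall>j\<in>{1..d} - I. \<exists>Q1. Q1 \<in> Psi \<nu> n \<and> P j Q1"
  proof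
    fix j assume j: "j \<in> {1..d} - I"
    then obtain i where "1 \<le> i" "i < j" "\<nu> (of_nat (j choose i)) = 0"
      using unit_binomial[of j] by (auto simp: I_def)
    from coeff_R_large[OF this] show "\<exists>Q1. Q1 \<in> Psi \<nu> n \<and> P j Q1"
      unfolding P_def by blast
  qed
  from bchoice[OF this] obtain f where f: "\<forall>j\<in>{1..d} - I. f j \<in> Psi \<nu> n \<and> P j (f j)" ..
  \<comment> \<open>Only finitely many j up to d are concerned, so one key polynomial lies beyond
    all their thresholds.\<close>
  have "\<exists>Q1\<in>Psi \<nu> n. \<forall>Q'\<in>insert Q (f ` ({1..d} - I)). \<nu> Q' < \<nu> Q1"
    by (rule psi_above) (use f Q in auto)
  then obtain Q1 where Q1: "Q1 \<in> Psi \<nu> n" "\<nu> Q < \<nu> Q1" "\<And>j. j \<in> {1..d} - I \<Longrightarrow> \<nu> (f j) < \<nu> Q1"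
    by blast
  obtain \<sigma> where \<sigma>: "\<nu> Q1 < \<nu> (Qf \<sigma>)"
    using Qf_cofinal Q1(1) by blast
  \<comment> \<open>The index 0 is retained although \<partial>_0 L (Q) = F is not stable: its term
    is the summand L(h).\<close>
  define J where "J = {i \<in> I \<union> {0}. i \<le> d}"
  have "limit_key_poly \<nu> n (poly L (Q - Qf \<theta>) +
        (\<Sum>i\<in>{i \<in> I. i \<le> d}. poly (hasse i L) (Q - Qf \<theta>) * Qf \<theta> ^ i)) \<and>
      (\<exists>(a :: nat \<Rightarrow> 'a poly) N. (\<forall>i. degree (a i) < n) \<and>
        limit_key_poly \<nu> n (\<Sum>i\<in>{i \<in> I \<union> {0}. i \<le> N}. a i * Qf \<theta> ^ i))"
    if "\<sigma> < \<theta>" for \<theta>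
  proof -
    let ?Q = "Qf \<theta>"
    have \<theta>: "?Q \<in> Psi \<nu> n" "\<nu> Q1 < \<nu> ?Q"
      using Qf_Psi Qf_mono that \<sigma> by (auto intro: less_trans)
    have large: "ereal Bbar < \<nu> (coeff (R ?Q) j) + ereal (j * val_of ?Q)" if "j \<in> {..d} - J" for j
    proof -
      have j: "j \<in> {1..d} - I"
        using that by (cases "j = 0") (auto simp: J_def)
      then have "P j (f j)"
        using f by blast
      then show ?thesis
        using \<theta>(1) less_trans[OF Q1(3)[OF j] \<theta>(2)] by (simp add: P_def)
    qed
    have Q\<theta>: "\<nu> Q < \<nu> ?Q"
      using Q1(2) \<theta>(2) by (rule less_trans)
    have J: "J \<subseteq> {..d}"
      by (auto simp: J_def)
    have sums: "limit_key_poly \<nu> n (\<Sum>j\<in>J. coeff (M ?Q) j * ?Q ^ j)"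
      "limit_key_poly \<nu> n (\<Sum>j\<in>J. coeff (R ?Q) j * ?Q ^ j)"
      by (rule truncated_sums[OF \<theta>(1) Q\<theta> J large], assumption)+
    have "0 \<notin> I"
      by (auto simp: I_def)
    moreover have "J = insert 0 {i \<in> I. i \<le> d}"
      by (auto simp: J_def)
    ultimately have "(\<Sum>j\<in>J. coeff (M ?Q) j * ?Q ^ j) = poly L (Q - ?Q) +
        (\<Sum>i\<in>{i \<in> I. i \<le> d}. poly (hasse i L) (Q - ?Q) * ?Q ^ i)"
      by (simp add: coeff_M)
    with sums(1) have "limit_key_poly \<nu> n (poly L (Q - ?Q) +
        (\<Sum>i\<in>{i \<in> I. i \<le> d}. poly (hasse i L) (Q - ?Q) * ?Q ^ i))"
      by simp
    moreover have "limit_key_poly \<nu> n (\<Sum>i\<in>{i \<in> I \<union> {0}. i \<le> d}. coeff (R ?Q) i * ?Q ^ i)"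
      using sums(2) unfolding J_def .
    ultimately show ?thesis
      using degree_coeff_R[OF \<theta>(1)] by (intro conjI exI[of _ "coeff (R ?Q)"] exI[of _ d] allI)
  qed
  then show ?thesis
    unfolding Let_def I_def by (intro exI[of _ \<sigma>] allI impI)
qed

end
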